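(* If the subordinator $\xi$ has no killing term and its jumps are bounded above by some fixed and finite constant $c>0$, equivalently $\overline{\Pi}(x)=0$ for $x>c$, then the random variable $\log I$ is not infinitely divisible.
   Context: A (possibly killed) subordinator $\xi$ is a $[0,\infty]$-valued Lévy process with non-decreasing paths and absorbing state $+\infty$. Its Laplace exponent is $\phi(\lambda)=-\log\mathbf{E}[e^{-\lambda\xi_1}]=q+\lambda a+\int_{(0,\infty)}(1-e^{-\lambda x})\,\Pi(dx)$ for $\lambda\ge 0$, where $q\ge 0$ is the killing term, $a\ge 0$ is the drift, and $\Pi$ is the Lévy measure, a measure on $(0,\infty)$ with $\int_{(0,\infty)}(x\wedge 1)\,\Pi(dx)<\infty$. No killing term means $q=0$. The Lévy tail is $\overline{\Pi}(x)=q+\Pi(x,\infty)$ for $x>0$. The exponential functional of $\xi$ is $I=\int_0^\infty e^{-\xi_s}\,ds$.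
   Formalization: The Lévy measure is additionally assumed nonzero, since for a pure drift ξ_t = at with a > 0 the variable log I = −log a is constant, hence infinitely divisible, and for ξ = 0 the functional I is infinite. *)

theory Defs
  imports "HOL-Probability.Probability"
begin

definition past_events :: "'a measure \<Rightarrow> (real \<Rightarrow> 'a \<Rightarrow> ennreal) \<Rightarrow> real \<Rightarrow> 'a set set" where
  "past_events M \<xi> t =
     sigma_sets (space M) {\<xi> u -` B \<inter> space M | u B. 0 \<le> u \<and> u \<le> t \<and> B \<in> sets borel}"

text \<open>
  Possibly killed subordinators, indexed by real times (only times \<open>\<ge> 0\<close> matter). Left limits
  and absorption at \<open>\<infinity>\<close> follow from monotonicity of the paths. The last assumption says
  that, given survival up to time \<open>t\<close>, the next increment is independent of the past and
  distributed as \<open>\<xi> s\<close>, where the value \<open>\<infinity>\<close> (killing) is allowed; without killing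
  it reduces to independence and stationarity of increments.
\<close>

locale subordinator = prob_space M for M :: "'a measure" +
  fixes \<xi> :: "real \<Rightarrow> 'a \<Rightarrow> ennreal"
  assumes measurable_process: "0 \<le> t \<Longrightarrow> \<xi> t \<in> borel_measurable M"
    and starts_at_0: "AE \<omega> in M. \<xi> 0 \<omega> = 0"
    and mono_paths: "\<omega> \<in> space M \<Longrightarrow> mono_on {0..} (\<lambda>t. \<xi> t \<omega>)"
    and right_continuous_paths:
      "\<omega> \<in> space M \<Longrightarrow> 0 \<le> t \<Longrightarrow> continuous (at_right t) (\<lambda>s. \<xi> s \<omega>)"
    and increments:
      "0 \<le> t \<Longrightarrow> 0 \<le> s \<Longrightarrow> A \<in> past_events M \<xi> t \<Longrightarrow> B \<in> sets borel \<Longrightarrow>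
        prob {\<omega> \<in> A. \<xi> t \<omega> < \<infinity> \<and> \<xi> (t + s) \<omega> - \<xi> t \<omega> \<in> B} =
        prob {\<omega> \<in> A. \<xi> t \<omega> < \<infinity>} * prob {\<omega> \<in> space M. \<xi> s \<omega> \<in> B}"

text \<open>\<open>exp_neg l x\<close> is \<open>exp (- l * x)\<close>, with value \<open>0\<close> at \<open>x = \<infinity>\<close> also for \<open>l = 0\<close>.\<close>

definition exp_neg :: "real \<Rightarrow> ennreal \<Rightarrow> real" where
  "exp_neg l x = (if x = \<infinity> then 0 else exp (- l * enn2real x))"

definition laplace_exponent :: "'a measure \<Rightarrow> (real \<Rightarrow> 'a \<Rightarrow> ennreal) \<Rightarrow> real \<Rightarrow> real" where
  "laplace_exponent M \<xi> l = - ln (\<integral>\<omega>. exp_neg l (\<xi> 1 \<omega>) \<partial>M)"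

text \<open>A measure on \<open>(0, \<infinity>)\<close> is encoded as a Borel measure on the line vanishing on \<open>(-\<infinity>, 0]\<close>.\<close>

definition levy_measure :: "real measure \<Rightarrow> bool" where
  "levy_measure \<Lambda> \<longleftrightarrow> sets \<Lambda> = sets borel \<and> emeasure \<Lambda> {..0} = 0 \<and>
     (\<integral>\<^sup>+x. ennreal (min x 1) \<partial>\<Lambda>) < \<infinity>"

definition has_characteristics ::
    "'a measure \<Rightarrow> (real \<Rightarrow> 'a \<Rightarrow> ennreal) \<Rightarrow> real \<Rightarrow> real \<Rightarrow> real measure \<Rightarrow> bool" where
  "has_characteristics M \<xi> q a \<Lambda> \<longleftrightarrow> 0 \<le> q \<and> 0 \<le> a \<and> levy_measure \<Lambda> \<and>
     (\<forall>l\<ge>0. laplace_exponent M \<xi> l = q + l * a + (\<integral>x. (1 - exp (- l * x)) \<partial>\<Lambda>))"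

definition levy_tail :: "real \<Rightarrow> real measure \<Rightarrow> real \<Rightarrow> ennreal" where
  "levy_tail q \<Lambda> x = ennreal q + emeasure \<Lambda> {x<..}"

definition exp_functional :: "(real \<Rightarrow> 'a \<Rightarrow> ennreal) \<Rightarrow> 'a \<Rightarrow> ennreal" where
  "exp_functional \<xi> \<omega> = (\<integral>\<^sup>+s\<in>{0..}. ennreal (exp_neg 1 (\<xi> s \<omega>)) \<partial>lborel)"

text \<open>
  The exponential functional lies in \<open>(0, \<infinity>)\<close> almost surely unless the process is identically
  \<open>0\<close>, so the values of this logarithm at \<open>0\<close> and \<open>\<infinity>\<close> play no role then.
\<close>

definition log_exp_functional :: "(real \<Rightarrow> 'a \<Rightarrow> ennreal) \<Rightarrow> 'a \<Rightarrow> real" where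
  "log_exp_functional \<xi> \<omega> = ln (enn2real (exp_functional \<xi> \<omega>))"

text \<open>For every \<open>n \<ge> 1\<close>, \<open>\<mu>\<close> is the law of a sum of \<open>n\<close> independent variables with a common law \<open>\<nu>\<close>.\<close>

definition infinitely_divisible :: "real measure \<Rightarrow> bool" where
  "infinitely_divisible \<mu> \<longleftrightarrow>
     (\<forall>n\<ge>1. \<exists>\<nu>. real_distribution \<nu> \<and>
        \<mu> = distr (\<Pi>\<^sub>M i\<in>{..<n::nat}. \<nu>) borel (\<lambda>x. \<Sum>i<n. x i))"

end

theory Submission
  imports Defs "HOL-Complex_Analysis.Complex_Analysis" "HOL-Real_Asymp.Real_Asymp"
begin

text \<open>
  Let \<open>\<phi>\<close> be the Laplace exponent, \<open>I\<close> the exponential functional and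
  \<open>m(z) = E(I powr z) = E(exp(z * log I))\<close> its Mellin transform. The law of \<open>log I\<close> fails
  to be infinitely divisible because \<open>m\<close> has a zero inside the half-plane \<open>Re z < 1\<close> on which
  the expectation converges. Indeed, if \<open>log I\<close> were a sum of \<open>n\<close> independent copies of some
  variable, the moment generating function of that variable would be a holomorphic \<open>n\<close>-th root of
  \<open>m\<close>; as \<open>n\<close> is arbitrary, \<open>n\<close> may exceed the order of any zero of \<open>m\<close>, so there are none
  (\<open>infinitely_divisible_moment_generating_function_nonzero\<close>).

  The zero comes from the functional equation \<open>z * m(z - 1) = \<phi>(z) * m(z)\<close>. Bounded jumps
  and the absence of killing make \<open>\<phi>(z) / z\<close> an entire function of exponential type. If it had
  no zero, it would be \<open>exp(\<alpha> * z + \<beta>)\<close>; but \<open>\<phi>(2) < 2 * \<phi>(1)\<close> forces \<open>Re \<alpha> < 0\<close>, and then \<open>\<phi>\<close>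
  would vanish at \<open>\<infinity>\<close>, although it increases and is positive. So \<open>\<phi>(w) / w = 0\<close> for some
  \<open>w\<close>, and \<open>Re w \<le> 0\<close> because \<open>Re \<phi> > 0\<close> on the right half-plane
  (\<open>exponent_quotient_has_zero\<close>). Hence \<open>m(w - 1) = 0\<close>.

  Two facts make \<open>m\<close> an actual expectation on \<open>Re z < 1\<close>. First, \<open>E I\<close> is finite. Second,
  \<open>I \<ge> exp(-\<xi>\<^sub>1)\<close>, and \<open>\<xi>\<^sub>1\<close> has exponential moments of all orders: its Laplace transform
  \<open>exp(-\<phi>)\<close> extends to an entire function, and the Taylor coefficients at \<open>1\<close> are, up to the
  sign \<open>(-1)^n\<close>, the nonnegative numbers \<open>E(\<xi>\<^sub>1^n * exp(-\<xi>\<^sub>1)) / n!\<close>, so that the convergence of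
  the Taylor series everywhere bounds every exponential moment
  (\<open>exponential_moments_of_entire_laplace_transform\<close>).

  The functional equation is needed only for real \<open>s\<close> in \<open>(0, 1)\<close>, by analytic continuation. There it
  is obtained by discretisation. The left Riemann sum of \<open>exp(-\<xi>)\<close> with mesh \<open>h\<close> is \<open>h * W\<close>, where the
  perpetuity \<open>W\<close> satisfies \<open>W = 1 + exp(-X) * W'\<close> with \<open>X\<close> distributed as \<open>\<xi>\<^sub>h\<close> and \<open>W'\<close> an
  independent copy of \<open>W\<close>. Therefore \<open>(1 - E(exp(-s * X))) * E(W^s) = E(W^s - (W - 1)^s)\<close>, and the mean
  value theorem encloses the right-hand side between \<open>s * E(W^(s-1))\<close> and
  \<open>s * E((W - 1)^(s-1))\<close>. After multiplication by \<open>h^(s-1)\<close> both bounds tend to \<open>s * E(I^(s-1))\<close> as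
  \<open>h\<close> tends to \<open>0\<close>, because \<open>h * (W - 1) \<le> I \<le> h * W\<close>, while
  \<open>(1 - E(exp(-s * X))) / h\<close> tends to \<open>\<phi>(s)\<close>.
\<close>

section \<open>Holomorphic moment generating functions and entire functions\<close>

text \<open>
  Termwise integration of a series whose sum of absolute values has an integrable majorant; it
  serves moment generating functions and Laplace exponents alike.
\<close>

lemma sums_integral_dominated:
  fixes f :: "nat \<Rightarrow> 'a \<Rightarrow> complex"
  assumes [measurable]: "\<And>n. f n \<in> borel_measurable M" and int: "integrable M g"
    and dom: "AE x in M. summable (\<lambda>n. norm (f n x)) \<and> (\<Sum>n. norm (f n x)) \<le> g x"
  shows "(\<lambda>n. integral\<^sup>L M (f n)) sums (\<integral>x. (\<Sum>n. f n x) \<partial>M)"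
proof -
  have partial: "AE x in M. (\<Sum>i<n. norm (f i x)) \<le> g x" for n
    using dom by eventually_elim (meson order_trans norm_ge_zero sum_le_suminf finite_lessThan)
  have int_f: "integrable M (f n)" for n
  proof (rule Bochner_Integration.integrable_bound[OF int])
    show "AE x in M. norm (f n x) \<le> norm (g x)"
      using partial[of "Suc n"]
    proof eventually_elim
      case (elim x)
      then show ?case using sum_nonneg[of "{..<n}" "\<lambda>i. norm (f i x)"] by simp
    qed
  qed measurable
  have "summable (\<lambda>n. \<integral>x. norm (f n x) \<partial>M)"
  proof (rule summableI_nonneg_bounded)
    fix n
    have "(\<Sum>i<n. \<integral>x. norm (f i x) \<partial>M) = (\<integral>x. (\<Sum>i<n. norm (f i x)) \<partial>M)"
      using int_f by (subst Bochner_Integration.integral_sum) auto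
    also have "\<dots> \<le> integral\<^sup>L M g"
      using int_f by (intro integral_mono_AE int partial) auto
    finally show "(\<Sum>i<n. \<integral>x. norm (f i x) \<partial>M) \<le> integral\<^sup>L M g" .
  qed simp
  then show ?thesis using dom int_f by (intro sums_integral) auto
qed

lemma exponential_integral_power_series:
  fixes w :: "'a \<Rightarrow> complex" and X :: "'a \<Rightarrow> real" and u :: complex
  assumes [measurable]: "w \<in> borel_measurable M" "X \<in> borel_measurable M"
    and int: "integrable M (\<lambda>x. norm (w x) * exp (r * \<bar>X x\<bar>))" and u: "norm u \<le> r"
  shows "(\<lambda>n. u ^ n / fact n * (\<integral>x. w x * of_real (X x) ^ n \<partial>M)) sums
    (\<integral>x. w x * exp (u * of_real (X x)) \<partial>M)"
proof -
  define f where "f n x = w x * (u * of_real (X x)) ^ n / fact n" for n x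
  have [measurable]: "f n \<in> borel_measurable M" for n unfolding f_def by measurable
  have norm_f: "(\<lambda>n. norm (f n x)) sums (norm (w x) * exp (norm u * \<bar>X x\<bar>))" for x
    using sums_mult[OF exp_converges[of "norm u * \<bar>X x\<bar>"], of "norm (w x)"]
    by (simp add: f_def norm_mult norm_divide norm_inverse norm_power divide_inverse mult_ac)
  have "(\<lambda>n. integral\<^sup>L M (f n)) sums (\<integral>x. (\<Sum>n. f n x) \<partial>M)"
  proof (rule sums_integral_dominated[OF _ int], measurable, intro AE_I2 conjI)
    fix x
    show "summable (\<lambda>n. norm (f n x))" using norm_f by (rule sums_summable)
    have "norm (w x) * exp (norm u * \<bar>X x\<bar>) \<le> norm (w x) * exp (r * \<bar>X x\<bar>)"
      using u by (intro mult_left_mono) (auto intro: mult_right_mono)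
    then show "(\<Sum>n. norm (f n x)) \<le> norm (w x) * exp (r * \<bar>X x\<bar>)"
      using sums_unique[OF norm_f[of x]] by simp
  qed
  moreover have "(\<Sum>n. f n x) = w x * exp (u * of_real (X x))" for x
    using sums_mult[OF exp_converges[of "u * of_real (X x)"], of "w x"]
    unfolding f_def by (intro sums_unique[symmetric]) (simp add: scaleR_conv_of_real divide_inverse mult_ac)
  moreover have "integral\<^sup>L M (f n) = u ^ n / fact n * (\<integral>x. w x * of_real (X x) ^ n \<partial>M)" for n
    unfolding f_def by (subst integral_mult_right_zero[symmetric]) (simp add: power_mult_distrib mult_ac)
  ultimately show ?thesis by simp
qed

text \<open>
  Around each point \<open>z\<close> of the half-plane, the exponential series of \<open>exp ((v - z) * X)\<close> can be
  integrated termwise against \<open>exp (z * X)\<close>, since \<open>exp (r * \<bar>X\<bar>)\<close> is at most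
  \<open>exp (r * X) + exp (- r * X)\<close>.
\<close>

lemma moment_generating_function_holomorphic:
  fixes X :: "'a \<Rightarrow> real"
  assumes [measurable]: "X \<in> borel_measurable M"
    and int: "\<And>s. s < b \<Longrightarrow> integrable M (\<lambda>x. exp (s * X x))"
  shows "(\<lambda>z. \<integral>x. exp (z * of_real (X x)) \<partial>M) holomorphic_on {z. Re z < b}"
proof -
  have "(\<lambda>z. \<integral>x. exp (z * of_real (X x)) \<partial>M) field_differentiable at z" if "Re z < b" for z
  proof -
    define r where "r = (b - Re z) / 2"
    have r: "0 < r" "Re z + r < b" using that by (simp_all add: r_def field_simps)
    have int': "integrable M (\<lambda>x. norm (exp (z * of_real (X x))) * exp (r * \<bar>X x\<bar>))"
    proof (rule Bochner_Integration.integrable_bound)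
      show "integrable M (\<lambda>x. exp ((Re z + r) * X x) + exp ((Re z - r) * X x))"
        using r by (intro Bochner_Integration.integrable_add int) auto
      show "AE x in M. norm (norm (exp (z * of_real (X x))) * exp (r * \<bar>X x\<bar>)) 
        \<le> norm (exp ((Re z + r) * X x) + exp ((Re z - r) * X x))"
      proof (intro AE_I2)
        fix x
        have "norm (exp (z * of_real (X x))) * exp (r * \<bar>X x\<bar>) = exp (Re z * X x + r * \<bar>X x\<bar>)"
          by (simp add: exp_add)
        also have "\<dots> \<le> exp ((Re z + r) * X x) + exp ((Re z - r) * X x)"
          by (cases "0 \<le> X x") (simp_all add: algebra_simps)
        finally show "norm (norm (exp (z * of_real (X x))) * exp (r * \<bar>X x\<bar>))
            \<le> norm (exp ((Re z + r) * X x) + exp ((Re z - r) * X x))" by simp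
      qed
    qed measurable
    have "(\<lambda>z. \<integral>x. exp (z * of_real (X x)) \<partial>M) holomorphic_on ball z r"
    proof (rule power_series_holomorphic)
      fix v assume "v \<in> ball z r"
      then have "norm (v - z) \<le> r" by (simp add: dist_norm norm_minus_commute)
      from exponential_integral_power_series[OF _ _ int' this]
      show "(\<lambda>n. (\<integral>x. exp (z * of_real (X x)) * of_real (X x) ^ n \<partial>M) / fact n * (v - z) ^ n) sums
        (\<integral>x. exp (v * of_real (X x)) \<partial>M)"
        by (simp add: exp_add[symmetric] algebra_simps mult_ac)
    qed
    then show ?thesis using r(1) by (meson centre_in_ball holomorphic_on_imp_differentiable_at open_ball)
  qed
  then show ?thesis by (auto simp: holomorphic_on_def intro: field_differentiable_at_within)
qed

text \<open>
  The case of Hadamard's factorisation theorem without zeros. A logarithm \<open>g\<close> of \<open>f\<close> is entire and has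
  real part at most linear in the modulus; the Borel-Caratheodory argument turns this into a linear
  bound on \<open>g\<close> itself, so \<open>g\<close> is affine by Liouville's theorem.
\<close>

lemma entire_nonvanishing_exponential_type:
  fixes f :: "complex \<Rightarrow> complex"
  assumes hol: "f holomorphic_on UNIV" and nz: "\<And>z. f z \<noteq> 0"
    and growth: "\<And>z. norm (f z) \<le> C * exp (B * norm z)" and B: "0 \<le> B"
  obtains \<alpha> \<beta> where "\<And>z. f z = exp (\<alpha> * z + \<beta>)"
proof -
  obtain g where g: "g holomorphic_on UNIV" "\<And>z. exp (g z) = f z"
    using holomorphic_logarithm_exists[of UNIV f 0] hol nz by auto
  have C: "0 < C" using growth[of 0] nz[of 0] order_less_le_trans[of 0 "norm (f 0)" C] by simp
  define h where "h z = g z - g 0" for z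
  have holh: "h holomorphic_on UNIV" unfolding h_def using g(1) by (intro holomorphic_intros)
  have h0: "h 0 = 0" by (simp add: h_def)
  define K where "K = \<bar>ln C\<bar> + \<bar>Re (g 0)\<bar> + 1"
  have K: "0 < K" by (simp add: K_def add_nonneg_pos)
  have Reh: "Re (h z) < K + B * norm z" for z
  proof -
    have "exp (Re (g z)) \<le> exp (ln C + B * norm z)"
      using growth[of z] C g(2)[of z] by (metis exp_add exp_ln norm_exp_eq_Re)
    then show ?thesis by (auto simp: h_def K_def)
  qed
  have bound: "norm (h z) \<le> (2 * K + 4 * B) * norm z ^ 1" if z: "1 \<le> norm z" for z
  proof -
    define R where "R = 2 * norm z"
    have R: "0 < R" using z by (simp add: R_def del: zero_less_norm_iff)
    define A where "A = K + B * R"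
    have A: "0 < A" using K B R by (simp add: A_def add_pos_nonneg)
    \<comment> \<open>The Moebius map \<open>u \<mapsto> u / (2 * A - u)\<close> sends the half-plane \<open>Re u < A\<close> into the unit disc,
      so the Schwarz lemma applies to \<open>k\<close>; the point \<open>z\<close> has modulus half the radius \<open>R\<close>.\<close>
    define k where "k v = h (of_real R * v) / (of_real (2 * A) - h (of_real R * v))" for v
    have ReA: "Re (h (of_real R * v)) < A" if "norm v < 1" for v
    proof -
      have "B * norm (of_real R * v) \<le> B * R"
        using that R B by (intro mult_left_mono) (auto simp: norm_mult)
      then show ?thesis using Reh[of "of_real R * v"] by (simp add: A_def)
    qed
    have den: "of_real (2 * A) - h (of_real R * v) \<noteq> 0" if "norm v < 1" for v
    proof
      assume "of_real (2 * A) - h (of_real R * v) = 0"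
      then have "2 * A = Re (h (of_real R * v))"
        by (metis Re_complex_of_real right_minus_eq)
      then show False using ReA[OF that] A by simp
    qed
    have "k holomorphic_on ball 0 1"
    proof -
      have "(\<lambda>v. h (of_real R * v)) holomorphic_on ball 0 1"
        using holomorphic_on_compose_gen[of "\<lambda>v. of_real R * v" "ball 0 1" h UNIV] holh
        by (auto simp: o_def intro!: holomorphic_intros)
      then show ?thesis unfolding k_def using den by (intro holomorphic_intros) auto
    qed
    moreover have "k 0 = 0" by (simp add: k_def h0)
    moreover have "norm (k v) < 1" if v: "norm v < 1" for v
    proof -
      have "(norm (h (of_real R * v)))\<^sup>2 < (norm (of_real (2 * A) - h (of_real R * v)))\<^sup>2"
        using ReA[OF v] A unfolding cmod_power2 by (simp add: power2_eq_square algebra_simps)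
      then have "norm (h (of_real R * v)) < norm (of_real (2 * A) - h (of_real R * v))"
        using norm_ge_zero power2_less_imp_less by blast
      then show ?thesis by (simp add: k_def norm_divide divide_less_eq)
    qed
    ultimately have *: "norm (k (z / of_real R)) \<le> norm (z / of_real R)"
      by (rule Schwarz_Lemma(1)) (use z in \<open>auto simp: norm_divide R_def\<close>)
    have half: "norm (z / of_real R) = 1 / 2" using z by (auto simp: norm_divide R_def)
    have "of_real R * (z / of_real R) = z" using R by simp
    then have "norm (h z) / norm (of_real (2 * A) - h z) \<le> 1 / 2"
      using * unfolding half k_def by (simp add: norm_divide)
    moreover have "0 < norm (of_real (2 * A) - h z)"
      using den[of "z / of_real R"] half R by simp
    ultimately have "norm (h z) \<le> norm (of_real (2 * A) - h z) / 2" by (simp add: field_simps)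
    also have "\<dots> \<le> (2 * A + norm (h z)) / 2"
      using norm_triangle_ineq4[of "of_real (2 * A)" "h z"] A by simp
    finally have "norm (h z) \<le> 2 * K + 4 * B * norm z" by (simp add: A_def R_def algebra_simps)
    also have "\<dots> \<le> (2 * K + 4 * B) * norm z ^ 1"
      using K z by (simp add: algebra_simps)
    finally show ?thesis .
  qed
  have "h z = deriv h 0 * z" for z
    using Liouville_polynomial[OF holh bound, where \<xi> = z] h0 by simp
  then have "f z = exp (deriv h 0 * z + g 0)" for z
    using g(2)[of z] by (metis h_def diff_add_cancel)
  then show ?thesis by (rule that)
qed

text \<open>
  A zero of order \<open>n\<close> cannot be a zero of an \<open>(n + 1)\<close>-st power of a holomorphic function: the power
  would vanish to order at least \<open>n + 1\<close>.
\<close>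

lemma holomorphic_with_all_roots_nonvanishing:
  fixes m :: "complex \<Rightarrow> complex"
  assumes D: "open D" "connected D" and hol: "m holomorphic_on D"
    and nz: "z0 \<in> D" "m z0 \<noteq> 0"
    and roots: "\<And>n. 1 \<le> n \<Longrightarrow> \<exists>h. h holomorphic_on D \<and> (\<forall>z\<in>D. m z = h z ^ n)"
    and p: "p \<in> D"
  shows "m p \<noteq> 0"
proof
  assume mp: "m p = 0"
  have "\<not> m constant_on D" using nz p mp unfolding constant_on_def by metis
  then obtain g r n where r: "0 < r" "ball p r \<subseteq> D" and g: "g holomorphic_on ball p r"
    "\<And>w. w \<in> ball p r \<Longrightarrow> m w = (w - p) ^ n * g w" "\<And>w. w \<in> ball p r \<Longrightarrow> g w \<noteq> 0"
    using holomorphic_factor_zero_nonconstant[OF hol D p mp] by metis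
  obtain h where h: "h holomorphic_on D" "\<And>z. z \<in> D \<Longrightarrow> m z = h z ^ Suc n"
    using roots[of "Suc n"] by auto
  have hp: "h p = 0" using h(2)[OF p] mp by auto
  have "(h has_field_derivative deriv h p) (at p)"
    using holomorphic_derivI[OF h(1) D(1) p] .
  then have "((\<lambda>w. h w / (w - p)) \<longlongrightarrow> deriv h p) (at p)"
    by (simp add: has_field_derivative_iff hp)
  then have "((\<lambda>w. (h w / (w - p)) ^ Suc n * (w - p)) \<longlongrightarrow> deriv h p ^ Suc n * (p - p)) (at p)"
    by (intro tendsto_intros)
  moreover have "eventually (\<lambda>w. (h w / (w - p)) ^ Suc n * (w - p) = g w) (at p)"
  proof -
    have "eventually (\<lambda>w. w \<in> ball p r - {p}) (at p)"
      using r(1) by (intro eventually_at_in_open) auto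
    then show ?thesis
    proof eventually_elim
      case (elim w)
      then have w: "w \<in> ball p r" "w - p \<noteq> 0" by auto
      then have "h w ^ Suc n = (w - p) ^ n * g w"
        using g(2)[OF w(1)] h(2)[of w] r(2) by (metis subsetD)
      then have "(h w / (w - p)) ^ Suc n * (w - p) = (w - p) ^ n * g w / (w - p) ^ Suc n * (w - p)"
        by (simp only: power_divide)
      then show ?case using w(2) by simp
    qed
  qed
  ultimately have "(g \<longlongrightarrow> 0) (at p)" by (simp add: filterlim_cong)
  moreover have "(g \<longlongrightarrow> g p) (at p)"
    using g(1) r(1) using holomorphic_on_imp_continuous_on[of g "ball p r"] by (simp add: continuous_on_eq_continuous_at isCont_def)
  ultimately have "g p = 0" by (meson LIM_unique)
  then show False using g(3)[of p] r(1) by simp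
qed

lemma zero_islimpt_of_real:
  assumes "0 < b"
  shows "(0 :: complex) islimpt of_real ` {0<..<b}"
proof (unfold islimpt_approachable, intro allI impI)
  fix e :: real assume e: "0 < e"
  have "complex_of_real (min e b / 2) \<in> of_real ` {0<..<b}"
    using e assms by (intro imageI) (auto simp: min_def)
  then show "\<exists>x'\<in>complex_of_real ` {0<..<b}. x' \<noteq> 0 \<and> dist x' 0 < e"
    by (rule bexI[rotated]) (use e assms in \<open>auto simp: dist_norm min_def\<close>)
qed

section \<open>Zeros and infinite divisibility\<close>

text \<open>
  If \<open>\<mu>\<close> is the law of a sum of \<open>n\<close> independent variables with law \<open>\<nu>\<close>, Tonelli's theorem transfers the
  exponential moments of \<open>\<mu>\<close> to \<open>\<nu>\<close>, and the moment generating function of \<open>\<nu>\<close> is a holomorphic \<open>n\<close>-th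
  root of that of \<open>\<mu>\<close>.
\<close>

lemma infinitely_divisible_moment_generating_function_nonzero:
  assumes inf_div: "infinitely_divisible \<mu>"
    and int: "\<And>s. s < b \<Longrightarrow> integrable \<mu> (\<lambda>x. exp (s * x))"
    and b: "0 < b" and z: "Re z < b"
  shows "(\<integral>x. exp (z * of_real x) \<partial>\<mu>) \<noteq> 0"
proof -
  define m where "m z = (\<integral>x. exp (z * of_real x) \<partial>\<mu>)" for z :: complex
  define D where "D = {z :: complex. Re z < b}"
  obtain \<nu>1 where \<nu>1: "real_distribution \<nu>1"
    "\<mu> = distr (\<Pi>\<^sub>M i\<in>{..<1::nat}. \<nu>1) borel (\<lambda>x. \<Sum>i<1. x i)"
    using inf_div unfolding infinitely_divisible_def by force
  interpret N1: real_distribution \<nu>1 by fact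
  interpret P1: product_prob_space "\<lambda>_::nat. \<nu>1" "{..<1}" ..
  have prob: "prob_space \<mu>"
    unfolding \<nu>1(2) by (intro P1.prob_space_distr) simp
  have sets_\<mu>[measurable_cong]: "sets \<mu> = sets borel" unfolding \<nu>1(2) by simp
  have hol: "m holomorphic_on D"
    unfolding m_def D_def by (rule moment_generating_function_holomorphic) (use int in auto)
  have "m z \<noteq> 0"
  proof (rule holomorphic_with_all_roots_nonvanishing[OF _ _ hol])
    show "open D" unfolding D_def by (rule open_halfspace_Re_lt)
    show "connected D" unfolding D_def by (intro convex_connected convex_halfspace_Re_lt)
    show "0 \<in> D" using b by (simp add: D_def)
    show "m 0 \<noteq> 0" using prob by (simp add: m_def prob_space.prob_space)
    show "z \<in> D" using z by (simp add: D_def)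
  next
    fix n :: nat assume n: "1 \<le> n"
    then obtain \<nu> where \<nu>: "real_distribution \<nu>"
      "\<mu> = distr (\<Pi>\<^sub>M i\<in>{..<n}. \<nu>) borel (\<lambda>x. \<Sum>i<n. x i)"
      using inf_div unfolding infinitely_divisible_def by force
    interpret N: real_distribution \<nu> by fact
    interpret P: product_prob_space "\<lambda>_::nat. \<nu>" "{..<n}" ..
    have int_\<nu>: "integrable \<nu> (\<lambda>y. exp (s * y))" if s: "s < b" for s
    proof (rule integrableI_bounded)
      have "(\<integral>\<^sup>+y. ennreal (exp (s * y)) \<partial>\<nu>) ^ n
          = (\<integral>\<^sup>+x. (\<Prod>i<n. ennreal (exp (s * x i))) \<partial>(\<Pi>\<^sub>M i\<in>{..<n}. \<nu>))"
        by (subst P.product_nn_integral_prod) auto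
      also have "\<dots> = (\<integral>\<^sup>+x. ennreal (exp (s * x)) \<partial>\<mu>)"
        unfolding \<nu>(2) by (subst nn_integral_distr) (auto simp: prod_ennreal exp_sum sum_distrib_left)
      also have "\<dots> < \<infinity>" using int[OF s] by (simp add: integrable_iff_bounded)
      finally show "(\<integral>\<^sup>+y. ennreal (norm (exp (s * y))) \<partial>\<nu>) < \<infinity>"
        using n by (simp add: power_less_top_ennreal)
    qed simp
    have int_c: "integrable \<nu> (\<lambda>y. exp (v * complex_of_real y))" if "v \<in> D" for v
      by (rule Bochner_Integration.integrable_bound[OF int_\<nu>[of "Re v"]]) (use that in \<open>auto simp: D_def\<close>)
    have "m v = (\<integral>y. exp (v * of_real y) \<partial>\<nu>) ^ n" if v: "v \<in> D" for v
    proof -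
      have "m v = (\<integral>x. (\<Prod>i<n. exp (v * of_real (x i))) \<partial>(\<Pi>\<^sub>M i\<in>{..<n}. \<nu>))"
        unfolding m_def \<nu>(2) by (subst integral_distr) (auto simp: exp_sum sum_distrib_left)
      also have "\<dots> = (\<integral>y. exp (v * of_real y) \<partial>\<nu>) ^ n"
        using int_c[OF v] by (subst P.product_integral_prod) auto
      finally show ?thesis .
    qed
    moreover have "(\<lambda>v. \<integral>y. exp (v * of_real y) \<partial>\<nu>) holomorphic_on D"
      unfolding D_def by (rule moment_generating_function_holomorphic) (use int_\<nu> in auto)
    ultimately show "\<exists>h. h holomorphic_on D \<and> (\<forall>z\<in>D. m z = h z ^ n)" by blast
  qed
  then show ?thesis by (simp add: m_def)
qed

section \<open>Exponential moments from the Laplace transform\<close>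

text \<open>
  A Landau-type theorem. The Taylor coefficients \<open>c n\<close> of the Laplace transform at \<open>1\<close> alternate in
  sign, being moments of \<open>- Y\<close> with weight \<open>exp (- Y)\<close>. To the left of \<open>1\<close> the Taylor series thus
  has nonnegative terms, and its convergence there yields by monotone convergence the integrability of
  the series of \<open>exp (r * Y) * exp (- Y)\<close>.
\<close>

lemma (in prob_space) exponential_moments_of_entire_laplace_transform:
  fixes Y :: "'a \<Rightarrow> real" and H :: "complex \<Rightarrow> complex"
  assumes [measurable]: "Y \<in> borel_measurable M" and nonneg: "\<And>\<omega>. 0 \<le> Y \<omega>"
    and hol: "H holomorphic_on UNIV"
    and laplace: "\<And>l. 0 < l \<Longrightarrow> H (of_real l) = of_real (\<integral>\<omega>. exp (- l * Y \<omega>) \<partial>M)"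
  shows "integrable M (\<lambda>\<omega>. exp (s * Y \<omega>))"
proof -
  define w where "w \<omega> = complex_of_real (exp (- Y \<omega>))" for \<omega>
  define L where "L u = (\<integral>\<omega>. w \<omega> * exp (u * of_real (- Y \<omega>)) \<partial>M)" for u
  define c where "c n = (\<integral>\<omega>. w \<omega> * of_real (- Y \<omega>) ^ n \<partial>M) / fact n" for n
  have [measurable]: "w \<in> borel_measurable M" unfolding w_def by measurable
  have bnd: "integrable M (\<lambda>\<omega>. norm (w \<omega>) * exp (1 / 2 * \<bar>- Y \<omega>\<bar>))"
  proof (rule integrable_const_bound[of _ 1])
    show "AE \<omega> in M. norm (norm (w \<omega>) * exp (1 / 2 * \<bar>- Y \<omega>\<bar>)) \<le> 1"
      using nonneg by (intro AE_I2) (simp add: w_def exp_add[symmetric])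
  qed measurable
  have L_sums: "(\<lambda>n. c n * u ^ n) sums L u" if "norm u \<le> 1 / 2" for u
    using exponential_integral_power_series[OF _ _ bnd that] by (simp add: L_def c_def mult_ac)
  have holL: "L holomorphic_on ball 0 (1 / 2)"
    by (rule power_series_holomorphic[of _ _ c]) (use L_sums in \<open>auto simp: dist_norm\<close>)
  have hol': "(\<lambda>u. H (1 + u)) holomorphic_on A" for A
  proof -
    have "(\<lambda>u :: complex. 1 + u) holomorphic_on A" by (intro holomorphic_intros)
    from holomorphic_on_compose_gen[OF this hol] show ?thesis by (simp add: o_def)
  qed
  have "L u - H (1 + u) = 0" if u: "norm u < 1 / 2" for u
  proof (rule analytic_continuation[of "\<lambda>u. L u - H (1 + u)" "ball 0 (1/2)" "of_real ` {0<..<1/2}" 0])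
    show "(\<lambda>u. L u - H (1 + u)) holomorphic_on ball 0 (1/2)"
      by (intro holomorphic_intros holL hol')
    show "0 islimpt (of_real ` {0<..<1/2} :: complex set)" by (rule zero_islimpt_of_real) simp
    show "L v - H (1 + v) = 0" if v: "v \<in> of_real ` {0<..<1/2}" for v
    proof -
      from v obtain t where t: "v = of_real t" "0 < t" by auto
      have "L v = (\<integral>\<omega>. of_real (exp (- (1 + t) * Y \<omega>)) \<partial>M)"
        unfolding L_def w_def t(1) by (simp add: exp_of_real[symmetric] exp_add[symmetric] algebra_simps)
      also have "\<dots> = H (1 + v)" using laplace[of "1 + t"] t by simp
      finally show ?thesis by simp
    qed
  qed (use u in \<open>auto simp: dist_norm\<close>)
  then have "(\<lambda>n. c n * u ^ n) sums H (1 + u)" if "norm u < 1 / 2" for u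
    using L_sums[of u] that by simp
  then have "(\<lambda>u. H (1 + u)) has_fps_expansion Abs_fps c"
    by (intro has_fps_expansionI eventually_nhds_in_open[of "ball 0 (1/2)", THEN eventually_mono])
       (auto simp: dist_norm)
  then have sums_H: "(\<lambda>n. c n * z ^ n) sums H (1 + z)" for z
    using has_fps_expansion_imp_sums_complex[of "\<lambda>u. H (1 + u)" "Abs_fps c" \<infinity> z] hol' by simp
  \<comment> \<open>Evaluating the Taylor series at \<open>1 - r\<close> controls the moment of exponent \<open>r - 1 \<ge> s\<close>.\<close>
  define r where "r = \<bar>s\<bar> + 1"
  have r: "0 < r" "s \<le> r - 1" by (auto simp: r_def)
  define g where "g n \<omega> = exp (- Y \<omega>) * (r * Y \<omega>) ^ n / fact n" for n \<omega>
  have g0: "0 \<le> g n \<omega>" for n \<omega> using r nonneg by (simp add: g_def)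
  have [measurable]: "g n \<in> borel_measurable M" for n unfolding g_def by measurable
  have g_sums: "(\<lambda>n. g n \<omega>) sums exp ((r - 1) * Y \<omega>)" for \<omega>
    using sums_mult[OF exp_converges[of "r * Y \<omega>"], of "exp (- Y \<omega>)"]
    by (simp add: g_def divide_inverse mult_ac exp_add[symmetric] algebra_simps)
  have int_g: "integrable M (g n)" for n
  proof (rule integrable_const_bound[of _ "r ^ n"])
    have "Y \<omega> ^ n / fact n \<le> exp (Y \<omega>)" for \<omega>
      using sum_le_suminf[OF sums_summable[OF exp_converges[of "Y \<omega>"]], of "{n}"]
        sums_unique[OF exp_converges[of "Y \<omega>"]] nonneg[of \<omega>] by (simp add: divide_inverse mult.commute)
    then have "exp (- Y \<omega>) * (Y \<omega> ^ n / fact n) \<le> exp (- Y \<omega>) * exp (Y \<omega>)" for \<omega>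
      by (intro mult_left_mono) auto
    then have "r ^ n * (exp (- Y \<omega>) * (Y \<omega> ^ n / fact n)) \<le> r ^ n * 1" for \<omega>
      using r by (intro mult_left_mono) (auto simp: exp_minus)
    then have "g n \<omega> \<le> r ^ n" for \<omega> by (simp add: g_def power_mult_distrib mult_ac)
    then show "AE \<omega> in M. norm (g n \<omega>) \<le> r ^ n"
      by (intro AE_I2) (simp only: real_norm_def abs_of_nonneg[OF g0])
  qed measurable
  have "c n * (of_real (- r)) ^ n = of_real (integral\<^sup>L M (g n))" for n
  proof -
    have "of_real (integral\<^sup>L M (g n)) = (\<integral>\<omega>. (of_real (- r)) ^ n / fact n * (w \<omega> * of_real (- Y \<omega>) ^ n) \<partial>M)"
      by (subst integral_complex_of_real[symmetric], intro Bochner_Integration.integral_cong)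
         (auto simp: g_def w_def power_mult_distrib[symmetric] mult_ac)
    also have "\<dots> = (of_real (- r)) ^ n / fact n * (\<integral>\<omega>. w \<omega> * of_real (- Y \<omega>) ^ n \<partial>M)"
      by (rule integral_mult_right_zero)
    finally show ?thesis by (simp add: c_def)
  qed
  then have "summable (\<lambda>n. complex_of_real (integral\<^sup>L M (g n)))"
    using sums_summable[OF sums_H[of "of_real (- r)"]] by simp
  then have summ: "summable (\<lambda>n. integral\<^sup>L M (g n))"
    using summable_complex_of_real by blast
  have "integrable M (\<lambda>\<omega>. exp ((r - 1) * Y \<omega>))"
  proof (rule integrableI_bounded)
    have "(\<integral>\<^sup>+\<omega>. ennreal (norm (exp ((r - 1) * Y \<omega>))) \<partial>M) = (\<integral>\<^sup>+\<omega>. (\<Sum>n. ennreal (g n \<omega>)) \<partial>M)"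
      using suminf_ennreal_eq[OF g0 g_sums] by (intro nn_integral_cong) simp
    also have "\<dots> = (\<Sum>n. \<integral>\<^sup>+\<omega>. ennreal (g n \<omega>) \<partial>M)" by (intro nn_integral_suminf) measurable
    also have "\<dots> = (\<Sum>n. ennreal (integral\<^sup>L M (g n)))"
      using int_g g0 by (subst nn_integral_eq_integral) auto
    also have "\<dots> < \<infinity>"
      using summ g0 by (simp add: less_top ennreal_suminf_neq_top)
    finally show "(\<integral>\<^sup>+\<omega>. ennreal (norm (exp ((r - 1) * Y \<omega>))) \<partial>M) < \<infinity>" .
  qed measurable
  then show ?thesis
    by (rule Bochner_Integration.integrable_bound) (use r nonneg in \<open>auto intro!: mult_right_mono\<close>)
qed

section \<open>Laplace exponents of bounded jump measures\<close>

text \<open>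
  This is \<open>\<phi>(z) / z\<close> for \<open>\<phi>(z) = a * z + \<integral>(1 - exp (- z * x)) \<Lambda>(dx)\<close>, with the removable
  singularity at \<open>0\<close> filled by the limit \<open>x\<close> of the integrand.
\<close>

definition exponent_quotient :: "real \<Rightarrow> real measure \<Rightarrow> complex \<Rightarrow> complex" where
  "exponent_quotient a \<Lambda> z =
     of_real a + (\<integral>x. (if z = 0 then of_real x else (1 - exp (- z * of_real x)) / z) \<partial>\<Lambda>)"

lemma norm_one_minus_exp_le: 
  assumes "0 \<le> Re z" "0 \<le> x"
  shows "norm (1 - exp (- z * of_real x)) \<le> norm z * x"
proof -
  have "norm (exp (- z * of_real x) - exp 0) \<le> 1 * norm (- z * of_real x - 0)"
  proof (rule field_differentiable_bound[of "{z. Re z \<le> 0}" exp exp])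
    show "convex {z. Re z \<le> 0}" by (rule convex_halfspace_Re_le)
    show "(exp has_field_derivative exp w) (at w within {z. Re z \<le> 0})" for w :: complex
      by (rule DERIV_subset[OF DERIV_exp]) simp
  qed (use assms in auto)
  then show ?thesis using assms by (simp add: norm_mult norm_minus_commute)
qed

locale bounded_jump_measure =
  fixes a c :: real and \<Lambda> :: "real measure"
  assumes sets_\<Lambda>[measurable_cong]: "sets \<Lambda> = sets borel"
    and drift_nonneg: "0 \<le> a" and c_pos: "0 < c"
    and support: "AE x in \<Lambda>. 0 < x \<and> x \<le> c"
    and integrable_jump: "integrable \<Lambda> (\<lambda>x. x)"
    and nontrivial: "emeasure \<Lambda> (space \<Lambda>) \<noteq> 0"
begin

abbreviation ratio where "ratio \<equiv> exponent_quotient a \<Lambda>"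

definition exponent :: "real \<Rightarrow> real" where
  "exponent l = l * a + (\<integral>x. (1 - exp (- l * x)) \<partial>\<Lambda>)"

lemma exponent_0: "exponent 0 = 0"
  by (simp add: exponent_def)

text \<open>
  The measure may be infinite, so strict positivity is obtained from the characterisation of
  vanishing integrals of nonnegative functions.
\<close>

lemma integral_pos:
  fixes g :: "real \<Rightarrow> real"
  assumes int: "integrable \<Lambda> g" and pos: "AE x in \<Lambda>. 0 < x \<longrightarrow> 0 < g x"
  shows "0 < integral\<^sup>L \<Lambda> g"
proof -
  have pos': "AE x in \<Lambda>. 0 < g x" using pos support by eventually_elim auto
  have "integral\<^sup>L \<Lambda> g \<noteq> 0"
  proof
    assume "integral\<^sup>L \<Lambda> g = 0"
    moreover have "AE x in \<Lambda>. 0 \<le> g x" using pos' by eventually_elim simp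
    ultimately have "AE x in \<Lambda>. g x = 0" using integral_nonneg_eq_0_iff_AE[OF int] by blast
    with pos' have "AE x in \<Lambda>. False" by eventually_elim simp
    then show False using nontrivial by (simp add: AE_iff_null null_sets_def)
  qed
  moreover have "0 \<le> integral\<^sup>L \<Lambda> g" by (auto intro!: integral_nonneg_AE eventually_mono[OF pos'])
  ultimately show ?thesis by simp
qed

lemma integrable_one_minus_exp:
  assumes "0 \<le> Re z"
  shows "integrable \<Lambda> (\<lambda>x. 1 - exp (- z * of_real x))"
proof (rule Bochner_Integration.integrable_bound)
  show "integrable \<Lambda> (\<lambda>x. norm z * x)" using integrable_jump by simp
  show "AE x in \<Lambda>. norm (1 - exp (- z * of_real x)) \<le> norm (norm z * x)"
    using support by eventually_elim (use norm_one_minus_exp_le[OF assms] in \<open>simp add: abs_mult\<close>)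
qed measurable

lemma integrable_one_minus_exp_real:
  assumes "0 \<le> l"
  shows "integrable \<Lambda> (\<lambda>x. 1 - exp (- l * x))"
proof -
  have "integrable \<Lambda> (\<lambda>x. Re (1 - exp (- of_real l * of_real x)))"
    using integrable_one_minus_exp[of "of_real l"] assms by (intro integrable_Re) simp
  then show ?thesis by (simp add: Re_exp)
qed

lemma exponent_quotient_mult:
  assumes "z \<noteq> 0"
  shows "ratio z * z = of_real a * z + (\<integral>x. (1 - exp (- z * of_real x)) \<partial>\<Lambda>)"
  using assms by (simp add: exponent_quotient_def distrib_right)

lemma exponent_quotient_of_real:
  assumes "0 < l"
  shows "ratio (of_real l) = of_real (exponent l / l)"
proof -
  have "ratio (of_real l) * of_real l = of_real (exponent l)"
  proof -
    have "(\<integral>x. (1 - exp (- of_real l * complex_of_real x)) \<partial>\<Lambda>) = of_real (\<integral>x. (1 - exp (- l * x)) \<partial>\<Lambda>)"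
      by (subst integral_complex_of_real[symmetric], intro Bochner_Integration.integral_cong)
         (simp_all add: exp_of_real[symmetric])
    then show ?thesis
      using exponent_quotient_mult[of "of_real l"] assms by (simp add: exponent_def mult.commute)
  qed
  then show ?thesis using assms by (simp add: field_simps)
qed

lemma exponent_pos: "0 < l \<Longrightarrow> 0 < exponent l"
  unfolding exponent_def using drift_nonneg
  by (intro add_nonneg_pos integral_pos integrable_one_minus_exp_real AE_I2) auto

lemma exponent_mono:
  assumes "0 \<le> l" "l \<le> l'"
  shows "exponent l \<le> exponent l'"
  unfolding exponent_def
proof (intro add_mono mult_right_mono assms drift_nonneg integral_mono_AE integrable_one_minus_exp_real)
  show "AE x in \<Lambda>. 1 - exp (- l * x) \<le> 1 - exp (- l' * x)"
    using support by eventually_elim (use assms in \<open>auto intro: mult_right_mono\<close>)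
qed (use assms in auto)

text \<open>
  The integrand of \<open>2 * \<phi>(1) - \<phi>(2)\<close> is the square \<open>(1 - exp (- x))\<^sup>2\<close>.
\<close>

lemma exponent_double: "exponent 2 < 2 * exponent 1"
proof -
  have "0 < (\<integral>x. 2 * (1 - exp (- 1 * x)) - (1 - exp (- 2 * x)) \<partial>\<Lambda>)"
  proof (rule integral_pos)
    show "integrable \<Lambda> (\<lambda>x. 2 * (1 - exp (- 1 * x)) - (1 - exp (- 2 * x)))"
      by (intro Bochner_Integration.integrable_diff integrable_mult_right integrable_one_minus_exp_real) auto
    have "2 * (1 - exp (- 1 * x)) - (1 - exp (- 2 * x)) = (1 - exp (- x))\<^sup>2" for x :: real
      by (simp add: power2_eq_square algebra_simps exp_add[symmetric])
    then show "AE x in \<Lambda>. 0 < x \<longrightarrow> 0 < 2 * (1 - exp (- 1 * x)) - (1 - exp (- 2 * x))"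
      by (intro AE_I2) auto
  qed
  also have "\<dots> = 2 * (\<integral>x. 1 - exp (- 1 * x) \<partial>\<Lambda>) - (\<integral>x. 1 - exp (- 2 * x) \<partial>\<Lambda>)"
    by (subst Bochner_Integration.integral_diff)
       (use integrable_one_minus_exp_real[of 1] integrable_one_minus_exp_real[of 2]
         in \<open>simp_all only: integrable_mult_right integral_mult_right_zero zero_le_one zero_le_numeral\<close>)
  finally show ?thesis by (simp add: exponent_def)
qed

text \<open>
  As \<open>(1 - exp (- z * x)) / z\<close> is the sum of \<open>(- z)^n * x^(n+1) / (n+1)!\<close>, whose terms are dominated
  by those of \<open>x * exp (\<bar>z\<bar> * x)\<close>, bounded jumps give both an everywhere convergent power series and
  exponential type.
\<close>

lemma exponent_quotient_series:
  obtains b where "\<And>z. (\<lambda>n. b n * z ^ n) sums ratio z"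
    and "\<And>z. norm (ratio z) \<le> (a + (\<integral>x. x \<partial>\<Lambda>)) * exp (c * norm z)"
proof -
  define f where "f z n x = (- z) ^ n * of_real x ^ Suc n / fact (Suc n)" for z :: complex and n and x :: real
  define b where "b n = (if n = 0 then of_real a else 0) + (\<integral>x. f 1 n x \<partial>\<Lambda>)" for n
  have f_norm: "norm (f z n x) \<le> x * (inverse (fact n) * (norm z * x) ^ n)" if "0 \<le> x" for z n x
  proof -
    have "inverse (fact (Suc n)) \<le> (inverse (fact n) :: real)"
      by (intro le_imp_inverse_le fact_mono) auto
    then have "x * (norm z * x) ^ n * inverse (fact (Suc n)) \<le> x * (norm z * x) ^ n * inverse (fact n)"
      using that by (intro mult_left_mono) auto
    then show ?thesis using that
      by (simp add: f_def norm_mult norm_power norm_divide norm_inverse power_mult_distrib divide_inverse mult_ac del: fact_Suc)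
  qed
  have exps: "(\<lambda>n. x * (inverse (fact n) * (norm z * x) ^ n)) sums (x * exp (norm z * x))" for x :: real and z :: complex
    using sums_mult[OF exp_converges[of "norm z * x"], of x] by (simp add: mult_ac)
  have dom: "AE x in \<Lambda>. summable (\<lambda>n. norm (f z n x)) \<and> (\<Sum>n. norm (f z n x)) \<le> exp (c * norm z) * x" for z
    using support
  proof eventually_elim
    case (elim x)
    have s: "summable (\<lambda>n. norm (f z n x))"
      by (rule summable_comparison_test'[OF sums_summable[OF exps[of x z]], of 0]) (use f_norm elim in auto)
    have "(\<Sum>n. norm (f z n x)) \<le> x * exp (norm z * x)"
      using suminf_le[OF f_norm s sums_summable[OF exps]] elim sums_unique[OF exps[of x z]] by simp
    also have "\<dots> \<le> x * exp (c * norm z)"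
      using elim by (intro mult_left_mono) (auto simp: mult.commute intro: mult_right_mono)
    finally show ?case using s by (simp add: mult.commute)
  qed
  have [measurable]: "f z n \<in> borel_measurable \<Lambda>" for z n unfolding f_def by measurable
  have f_suminf: "(\<Sum>n. f z n x) = (if z = 0 then of_real x else (1 - exp (- z * of_real x)) / z)" for z x
  proof (cases "z = 0")
    case True
    have "(\<lambda>n. f z n x) = (\<lambda>n. if n = 0 then of_real x else 0)" using True by (auto simp: f_def)
    moreover have "(\<lambda>n. if n = 0 then complex_of_real x else 0) sums of_real x"
      by (rule sums_single)
    ultimately show ?thesis using True by (simp add: sums_unique[symmetric])
  next
    case False
    have "(\<lambda>n. (- z * of_real x) ^ Suc n /\<^sub>R fact (Suc n)) sums (exp (- z * of_real x) - 1)"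
      using exp_converges[of "- z * of_real x"]
      by (subst sums_Suc_iff) simp
    moreover have "f z n x = - 1 / z * ((- z * of_real x) ^ Suc n /\<^sub>R fact (Suc n))" for n
      unfolding power_mult_distrib f_def using False
      by (simp add: scaleR_conv_of_real divide_inverse del: fact_Suc)
    ultimately have "(\<lambda>n. f z n x) sums (- 1 / z * (exp (- z * of_real x) - 1))"
      by (simp only: sums_mult)
    then show ?thesis using False by (simp add: sums_unique[symmetric] field_simps)
  qed
  have int_dom: "integrable \<Lambda> (\<lambda>x. exp (c * norm z) * x)" for z :: complex using integrable_jump by simp
  have fz: "f z n x = z ^ n * f 1 n x" for z n x
    by (simp add: f_def power_minus[of z] mult_ac)
  have "(\<lambda>n. (if n = 0 then of_real a else 0) + integral\<^sup>L \<Lambda> (f z n)) sums ratio z" for z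
    using sums_add[OF sums_If_finite_set[of "{0}" "\<lambda>_. of_real a"] sums_integral_dominated[OF _ int_dom dom[of z]]]
    by (simp add: f_suminf exponent_quotient_def)
  moreover have "(if n = 0 then of_real a else 0) + integral\<^sup>L \<Lambda> (f z n) = b n * z ^ n" for z n
    unfolding b_def fz[of z n] by (simp add: distrib_right mult.commute)
  ultimately have 1: "(\<lambda>n. b n * z ^ n) sums ratio z" for z by simp
  have 2: "norm (ratio z) \<le> (a + (\<integral>x. x \<partial>\<Lambda>)) * exp (c * norm z)" for z
  proof -
    define F where "F x = (\<Sum>n. f z n x)" for x
    have [measurable]: "F \<in> borel_measurable \<Lambda>" unfolding F_def by measurable
    have F_le: "AE x in \<Lambda>. norm (F x) \<le> exp (c * norm z) * x"
      using dom[of z] unfolding F_def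
    proof eventually_elim
      case (elim x)
      then show ?case using summable_norm[of "\<lambda>n. f z n x"] by linarith
    qed
    have int_F: "integrable \<Lambda> F"
      by (rule Bochner_Integration.integrable_bound[OF int_dom[of z]]) (use F_le in auto)
    have "norm (integral\<^sup>L \<Lambda> F) \<le> (\<integral>x. norm (F x) \<partial>\<Lambda>)" by (rule integral_norm_bound)
    also have "\<dots> \<le> (\<integral>x. exp (c * norm z) * x \<partial>\<Lambda>)"
      by (intro integral_mono_AE int_dom integrable_norm int_F F_le)
    finally have "norm (integral\<^sup>L \<Lambda> F) \<le> exp (c * norm z) * (\<integral>x. x \<partial>\<Lambda>)" by simp
    moreover have "a * 1 \<le> a * exp (c * norm z)"
      using drift_nonneg c_pos by (intro mult_left_mono) auto
    moreover have "norm (of_real a :: complex) = a" using drift_nonneg by simp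
    ultimately have "norm (of_real a + integral\<^sup>L \<Lambda> F)
        \<le> a * exp (c * norm z) + exp (c * norm z) * (\<integral>x. x \<partial>\<Lambda>)"
      using norm_triangle_ineq[of "of_real a :: complex" "integral\<^sup>L \<Lambda> F"] by linarith
    also have "of_real a + integral\<^sup>L \<Lambda> F = ratio z"
      unfolding exponent_quotient_def F_def f_suminf ..
    also have "a * exp (c * norm z) + exp (c * norm z) * (\<integral>x. x \<partial>\<Lambda>)
        = (a + (\<integral>x. x \<partial>\<Lambda>)) * exp (c * norm z)"
      by (rule trans[OF _ distrib_right[symmetric]]) (simp only: mult.commute)
    finally show ?thesis .
  qed
  show thesis using 1 2 that by blast
qed

lemma exponent_quotient_holomorphic: "ratio holomorphic_on UNIV"
proof -
  obtain b where b: "\<And>z. (\<lambda>n. b n * z ^ n) sums ratio z" using exponent_quotient_series by blast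
  have "ratio field_differentiable at z" for z
  proof -
    have "ratio holomorphic_on ball 0 (norm z + 1)"
      by (rule power_series_holomorphic[of _ _ b]) (simp add: b)
    then show ?thesis by (rule holomorphic_on_imp_differentiable_at) auto
  qed
  then show ?thesis by (simp add: holomorphic_on_def field_differentiable_at_within)
qed

text \<open>
  On the positive axis the exponential would have to be \<open>exp (A * l + B)\<close> with \<open>A < 0\<close>, by
  \<open>exponent_double\<close>; then \<open>\<phi>(l) = l * exp (A * l + B)\<close> would tend to \<open>0\<close>, against monotonicity.
\<close>

lemma exponent_quotient_not_exponential: "\<not> (\<forall>z. ratio z = exp (\<alpha> * z + \<beta>))"
proof
  assume eq: "\<forall>z. ratio z = exp (\<alpha> * z + \<beta>)"
  define A B where "A = Re \<alpha>" and "B = Re \<beta>"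
  have ex: "exponent l = l * exp (A * l + B)" if l: "0 < l" for l
  proof -
    have "exponent l / l = norm (ratio (of_real l))"
      using l exponent_pos[OF l] by (simp add: exponent_quotient_of_real norm_divide)
    also have "\<dots> = exp (A * l + B)" by (simp add: eq A_def B_def)
    finally show ?thesis using l by (simp add: field_simps)
  qed
  have "exp (A * 2 + B) < exp (A * 1 + B)" using exponent_double ex[of 1] ex[of 2] by simp
  then have A: "A < 0" by simp
  have "((\<lambda>l. l * exp (A * l + B)) \<longlongrightarrow> 0) at_top" using A by real_asymp
  moreover have "eventually (\<lambda>l. exponent 1 \<le> l * exp (A * l + B)) at_top"
    using eventually_ge_at_top[of 1]
  proof eventually_elim
    case (elim l)
    then show ?case using exponent_mono[of 1 l] ex[of l] by simp
  qed
  ultimately have "exponent 1 \<le> 0" by (intro tendsto_lowerbound) auto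
  then show False using exponent_pos[of 1] by simp
qed

text \<open>
  The real part of \<open>1 - exp (- z * x)\<close> is positive when \<open>Re z\<close> and \<open>x\<close> are.
\<close>

lemma exponent_quotient_nonzero_right:
  assumes z: "0 < Re z"
  shows "ratio z \<noteq> 0"
proof
  assume "ratio z = 0"
  then have "Re (of_real a * z + (\<integral>x. (1 - exp (- z * of_real x)) \<partial>\<Lambda>)) = 0"
    using exponent_quotient_mult[of z] z by fastforce
  then have "a * Re z + (\<integral>x. Re (1 - exp (- z * of_real x)) \<partial>\<Lambda>) = 0"
    using integral_Re[OF integrable_one_minus_exp[of z]] z by simp
  moreover have "0 < (\<integral>x. Re (1 - exp (- z * of_real x)) \<partial>\<Lambda>)"
  proof (rule integral_pos)
    show "integrable \<Lambda> (\<lambda>x. Re (1 - exp (- z * of_real x)))"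
      using integrable_one_minus_exp[of z] z by (intro integrable_Re) simp
    have "Re (exp (- z * of_real x)) < 1" if "0 < x" for x
    proof -
      have "Re (exp (- z * of_real x)) \<le> norm (exp (- z * of_real x))" by (rule complex_Re_le_cmod)
      also have "\<dots> < 1" using z that by simp
      finally show ?thesis .
    qed
    then show "AE x in \<Lambda>. 0 < x \<longrightarrow> 0 < Re (1 - exp (- z * of_real x))"
      by (intro AE_I2) simp
  qed
  ultimately show False using z drift_nonneg
    by (metis add_nonneg_pos less_irrefl mult_nonneg_nonneg less_imp_le)
qed

lemma exponent_quotient_has_zero:
  obtains w where "Re w \<le> 0" "ratio w = 0"
proof -
  have "\<exists>w. ratio w = 0"
  proof (rule ccontr)
    assume nz: "\<not> (\<exists>w. ratio w = 0)"
    obtain C where "\<And>z. norm (ratio z) \<le> C * exp (c * norm z)"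
      using exponent_quotient_series by blast
    then obtain \<alpha> \<beta> where "\<And>z. ratio z = exp (\<alpha> * z + \<beta>)"
      using entire_nonvanishing_exponential_type[OF exponent_quotient_holomorphic] nz c_pos
      by (metis less_imp_le)
    then show False using exponent_quotient_not_exponential by blast
  qed
  then show thesis using that exponent_quotient_nonzero_right by (meson not_le)
qed

end

section \<open>Perpetuities with independent steps\<close>

text \<open>
  The sum of the products \<open>exp (- \<omega> 0) * ... * exp (- \<omega> (k - 1))\<close>, that is, the discrete
  counterpart of the exponential functional for a walk with steps \<open>\<omega>\<close>.
\<close>

definition perpetuity :: "(nat \<Rightarrow> real) \<Rightarrow> ennreal" where
  "perpetuity \<omega> = (\<Sum>k. ennreal (exp (- (\<Sum>j<k. \<omega> j))))"

lemma perpetuity_case_nat: "perpetuity (case_nat x \<omega>) = 1 + ennreal (exp (- x)) * perpetuity \<omega>"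
proof -
  define a where "a k = ennreal (exp (- (\<Sum>j<k. case_nat x \<omega> j)))" for k
  have "suminf a = a 0 + (\<Sum>k. a (Suc k))"
    using suminf_offset[OF summableI, of a 1] by (simp add: add.commute)
  then have "perpetuity (case_nat x \<omega>) =
      ennreal (exp 0) + (\<Sum>k. ennreal (exp (- (\<Sum>j<Suc k. case_nat x \<omega> j))))"
    unfolding perpetuity_def a_def by (simp only: lessThan_0 sum.empty minus_zero)
  also have "(\<Sum>k. ennreal (exp (- (\<Sum>j<Suc k. case_nat x \<omega> j))))
      = (\<Sum>k. ennreal (exp (- x)) * ennreal (exp (- (\<Sum>j<k. \<omega> j))))"
    by (intro suminf_cong) (simp add: sum.lessThan_Suc_shift ennreal_mult[symmetric] exp_add[symmetric] del: sum.lessThan_Suc)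
  finally show ?thesis by (simp add: perpetuity_def)
qed

lemma perpetuity_ge: "ennreal (1 + exp (- \<omega> 0)) \<le> perpetuity \<omega>"
proof -
  have "(\<Sum>k<2. ennreal (exp (- (\<Sum>j<k. \<omega> j)))) \<le> perpetuity \<omega>"
    unfolding perpetuity_def by (intro sum_le_suminf summableI) auto
  also have "(\<Sum>k<2. ennreal (exp (- (\<Sum>j<k. \<omega> j)))) = ennreal (1 + exp (- \<omega> 0))"
    by (simp add: numeral_2_eq_2 ennreal_plus)
  finally show ?thesis .
qed

lemma powr_increment_bounds:
  fixes x s :: real
  assumes "1 < x" "0 < s" "s < 1"
  shows "s * x powr (s - 1) \<le> x powr s - (x - 1) powr s"
    and "x powr s - (x - 1) powr s \<le> s * (x - 1) powr (s - 1)"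
proof -
  have "\<exists>z. x - 1 < z \<and> z < x \<and> x powr s - (x - 1) powr s = (x - (x - 1)) * (s * z powr (s - 1))"
    using assms by (intro MVT2) (auto intro!: derivative_eq_intros simp: powr_diff)
  then obtain z where z: "x - 1 < z" "z < x" "x powr s - (x - 1) powr s = s * z powr (s - 1)" by auto
  show "s * x powr (s - 1) \<le> x powr s - (x - 1) powr s"
    unfolding z(3) using z assms by (intro mult_left_mono powr_mono2') auto
  show "x powr s - (x - 1) powr s \<le> s * (x - 1) powr (s - 1)"
    unfolding z(3) using z assms by (intro mult_left_mono powr_mono2') auto
qed

locale iid_steps = real_distribution \<rho> for \<rho> :: "real measure"
begin

sublocale S: sequence_space \<rho> ..

lemma measurable_perpetuity[measurable]: "perpetuity \<in> borel_measurable S.S"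
  unfolding perpetuity_def by measurable

text \<open>
  Conditioning on the first step: a sequence of independent steps is a first step followed by an
  independent sequence with the same law.
\<close>

lemma nn_integral_first_step:
  assumes [measurable]: "g \<in> borel_measurable S.S"
  shows "(\<integral>\<^sup>+\<omega>. g \<omega> \<partial>S.S) = (\<integral>\<^sup>+x. \<integral>\<^sup>+\<omega>. g (case_nat x \<omega>) \<partial>S.S \<partial>\<rho>)"
proof -
  have "(\<integral>\<^sup>+\<omega>. g \<omega> \<partial>S.S) = (\<integral>\<^sup>+y. g (case y of (x, \<omega>) \<Rightarrow> case_nat x \<omega>) \<partial>(\<rho> \<Otimes>\<^sub>M S.S))"
    by (subst S.PiM_iter[symmetric]) (simp add: nn_integral_distr)
  also have "\<dots> = (\<integral>\<^sup>+x. \<integral>\<^sup>+\<omega>. g (case_nat x \<omega>) \<partial>S.S \<partial>\<rho>)"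
    by (subst S.nn_integral_fst[symmetric]) simp_all
  finally show ?thesis .
qed

lemma nn_integral_exp_partial_sum:
  "(\<integral>\<^sup>+\<omega>. ennreal (exp (- s * (\<Sum>j<k. \<omega> j))) \<partial>S.S) = (\<integral>\<^sup>+x. ennreal (exp (- s * x)) \<partial>\<rho>) ^ k"
proof (induction k)
  case 0
  then show ?case by (simp add: S.emeasure_space_1)
next
  case (Suc k)
  have "(\<integral>\<^sup>+\<omega>. ennreal (exp (- s * (\<Sum>j<Suc k. \<omega> j))) \<partial>S.S)
      = (\<integral>\<^sup>+x. \<integral>\<^sup>+\<omega>. ennreal (exp (- s * x)) * ennreal (exp (- s * (\<Sum>j<k. \<omega> j))) \<partial>S.S \<partial>\<rho>)"
    by (subst nn_integral_first_step)
       (simp_all add: sum.lessThan_Suc_shift ennreal_mult[symmetric] exp_add[symmetric] algebra_simps del: sum.lessThan_Suc)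
  also have "\<dots> = (\<integral>\<^sup>+x. ennreal (exp (- s * x)) \<partial>\<rho>) ^ Suc k"
    by (simp add: nn_integral_cmult nn_integral_multc Suc.IH[simplified] mult.commute)
  finally show ?case .
qed

lemma nn_integral_perpetuity_finite:
  assumes "(\<integral>\<^sup>+x. ennreal (exp (- x)) \<partial>\<rho>) < 1"
  shows "(\<integral>\<^sup>+\<omega>. perpetuity \<omega> \<partial>S.S) < \<infinity>"
proof -
  define m where "m = enn2real (\<integral>\<^sup>+x. ennreal (exp (- x)) \<partial>\<rho>)"
  have eq_m: "(\<integral>\<^sup>+x. ennreal (exp (- x)) \<partial>\<rho>) = ennreal m"
    unfolding m_def by (rule ennreal_enn2real[symmetric]) (use assms in \<open>metis ennreal_less_top less_trans ennreal_1 infinity_ennreal_def\<close>)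
  have m0: "0 \<le> m" by (simp add: m_def)
  moreover have "m < 1" using assms m0 unfolding eq_m by (simp add: ennreal_less_iff flip: ennreal_1)
  ultimately have m: "(\<integral>\<^sup>+x. ennreal (exp (- x)) \<partial>\<rho>) = ennreal m" "0 \<le> m" "m < 1" using eq_m by auto
  have "(\<integral>\<^sup>+\<omega>. perpetuity \<omega> \<partial>S.S) = (\<Sum>k. ennreal (m ^ k))"
    unfolding perpetuity_def
    by (subst nn_integral_suminf) (use nn_integral_exp_partial_sum[of 1] m in \<open>simp_all add: ennreal_power\<close>)
  also have "\<dots> = ennreal (1 / (1 - m))"
    using m geometric_sums[of m] by (intro suminf_ennreal_eq) auto
  finally show ?thesis by simp
qed

text \<open>
  By the first-step decomposition, \<open>V - 1\<close> has the same law as \<open>exp (- X) * V\<close> with \<open>X\<close>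
  an independent step, so the mean of \<open>V powr s - (V - 1) powr s\<close> is \<open>(1 - m)\<close> times the mean of
  \<open>V powr s\<close>; the mean value theorem bounds this increment on both sides.
\<close>

lemma perpetuity_moment_bounds:
  fixes s :: real
  defines "V \<equiv> \<lambda>\<omega>. enn2real (perpetuity \<omega>)"
    and "m \<equiv> \<integral>x. exp (- s * x) \<partial>\<rho>"
  assumes fin: "(\<integral>\<^sup>+\<omega>. perpetuity \<omega> \<partial>S.S) < \<infinity>" and s: "0 < s" "s < 1"
    and int_m: "integrable \<rho> (\<lambda>x. exp (- s * x))"
  shows "s * (\<integral>\<omega>. V \<omega> powr (s - 1) \<partial>S.S) \<le> (1 - m) * (\<integral>\<omega>. V \<omega> powr s \<partial>S.S)"
    and "integrable S.S (\<lambda>\<omega>. (V \<omega> - 1) powr (s - 1)) \<Longrightarrow>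
      (1 - m) * (\<integral>\<omega>. V \<omega> powr s \<partial>S.S) \<le> s * (\<integral>\<omega>. (V \<omega> - 1) powr (s - 1) \<partial>S.S)"
proof -
  have [measurable]: "V \<in> borel_measurable S.S" unfolding V_def by measurable
  have finite: "AE \<omega> in S.S. perpetuity \<omega> \<noteq> \<infinity>"
    using fin by (intro nn_integral_PInf_AE) auto
  have first: "AE \<omega> in S.S. perpetuity \<omega> = ennreal (V \<omega>)"
    using finite by eventually_elim (simp add: V_def ennreal_enn2real_if)
  have V_gt: "AE \<omega> in S.S. 1 < V \<omega>"
    using first
  proof eventually_elim
    case (elim \<omega>)
    from perpetuity_ge[of \<omega>] have "ennreal (1 + exp (- \<omega> 0)) \<le> ennreal (V \<omega>)" unfolding elim .
    then have "1 + exp (- \<omega> 0) \<le> V \<omega>" by (subst (asm) ennreal_le_iff) (simp_all add: V_def)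
    then show ?case using exp_gt_zero[of "- \<omega> 0"] by linarith
  qed
  have int_V: "integrable S.S V"
  proof (rule integrableI_bounded)
    have "(\<integral>\<^sup>+\<omega>. ennreal (norm (V \<omega>)) \<partial>S.S) = (\<integral>\<^sup>+\<omega>. perpetuity \<omega> \<partial>S.S)"
      by (rule nn_integral_cong_AE) (use first in \<open>eventually_elim, simp add: V_def\<close>)
    then show "(\<integral>\<^sup>+\<omega>. ennreal (norm (V \<omega>)) \<partial>S.S) < \<infinity>" using fin by simp
  qed measurable
  have int_powr: "integrable S.S (\<lambda>\<omega>. V \<omega> powr s)"
  proof (rule Bochner_Integration.integrable_bound[OF int_V])
    show "AE \<omega> in S.S. norm (V \<omega> powr s) \<le> norm (V \<omega>)"
      using V_gt by eventually_elim (use powr_mono[of s 1] s in force)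
  qed measurable
  have int_powr': "integrable S.S (\<lambda>\<omega>. (V \<omega> - 1) powr s)"
  proof (rule Bochner_Integration.integrable_bound[OF int_powr])
    show "AE \<omega> in S.S. norm ((V \<omega> - 1) powr s) \<le> norm (V \<omega> powr s)"
      using V_gt by eventually_elim (use s in \<open>auto intro: powr_mono2\<close>)
  qed measurable
  have int_low: "integrable S.S (\<lambda>\<omega>. V \<omega> powr (s - 1))"
  proof (rule S.integrable_const_bound[of _ 1])
    show "AE \<omega> in S.S. norm (V \<omega> powr (s - 1)) \<le> 1"
      using V_gt by eventually_elim (use s powr_mono2'[of "s - 1" 1] in force)
  qed measurable
  have m0: "0 \<le> m" by (simp add: m_def)
  have "ennreal (\<integral>\<omega>. (V \<omega> - 1) powr s \<partial>S.S) = (\<integral>\<^sup>+\<omega>. ennreal ((V \<omega> - 1) powr s) \<partial>S.S)"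
    by (rule nn_integral_eq_integral[symmetric, OF int_powr']) simp
  also have "\<dots> = (\<integral>\<^sup>+x. \<integral>\<^sup>+\<omega>. ennreal ((V (case_nat x \<omega>) - 1) powr s) \<partial>S.S \<partial>\<rho>)"
    by (rule nn_integral_first_step) measurable
  also have "\<dots> = (\<integral>\<^sup>+x. \<integral>\<^sup>+\<omega>. ennreal (exp (- s * x)) * ennreal (V \<omega> powr s) \<partial>S.S \<partial>\<rho>)"
  proof (rule nn_integral_cong, rule nn_integral_cong_AE)
    fix x
    show "AE \<omega> in S.S. ennreal ((V (case_nat x \<omega>) - 1) powr s) = ennreal (exp (- s * x)) * ennreal (V \<omega> powr s)"
      using first V_gt
    proof eventually_elim
      case (elim \<omega>)
      have "perpetuity (case_nat x \<omega>) = ennreal (1 + exp (- x) * V \<omega>)"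
        using elim by (simp add: perpetuity_case_nat ennreal_mult ennreal_plus)
      then have "V (case_nat x \<omega>) = enn2real (ennreal (1 + exp (- x) * V \<omega>))"
        by (simp only: V_def)
      then have "V (case_nat x \<omega>) - 1 = exp (- x) * V \<omega>"
        by (subst (asm) enn2real_ennreal) (use elim(2) in simp_all)
      then show ?case
        using elim by (simp add: powr_mult exp_powr_real ennreal_mult mult.commute)
    qed
  qed
  also have "\<dots> = ennreal m * ennreal (\<integral>\<omega>. V \<omega> powr s \<partial>S.S)"
    unfolding m_def
    by (simp add: nn_integral_cmult nn_integral_multc nn_integral_eq_integral[OF int_powr] nn_integral_eq_integral[OF int_m, simplified])
  finally have shift: "(\<integral>\<omega>. (V \<omega> - 1) powr s \<partial>S.S) = m * (\<integral>\<omega>. V \<omega> powr s \<partial>S.S)"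
    using m0 by (simp add: ennreal_mult[symmetric])
  have diff: "(\<integral>\<omega>. V \<omega> powr s - (V \<omega> - 1) powr s \<partial>S.S) = (1 - m) * (\<integral>\<omega>. V \<omega> powr s \<partial>S.S)"
    using int_powr int_powr' by (simp add: shift left_diff_distrib)
  have "(\<integral>\<omega>. s * V \<omega> powr (s - 1) \<partial>S.S) \<le> (\<integral>\<omega>. V \<omega> powr s - (V \<omega> - 1) powr s \<partial>S.S)"
  proof (rule integral_mono_AE)
    show "AE \<omega> in S.S. s * V \<omega> powr (s - 1) \<le> V \<omega> powr s - (V \<omega> - 1) powr s"
      using V_gt by eventually_elim (rule powr_increment_bounds(1)[OF _ s])
  qed (use int_powr int_powr' int_low in auto)
  then show "s * (\<integral>\<omega>. V \<omega> powr (s - 1) \<partial>S.S) \<le> (1 - m) * (\<integral>\<omega>. V \<omega> powr s \<partial>S.S)"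
    by (simp add: diff)
  show "(1 - m) * (\<integral>\<omega>. V \<omega> powr s \<partial>S.S) \<le> s * (\<integral>\<omega>. (V \<omega> - 1) powr (s - 1) \<partial>S.S)"
    if int_up: "integrable S.S (\<lambda>\<omega>. (V \<omega> - 1) powr (s - 1))"
  proof -
    have "(\<integral>\<omega>. V \<omega> powr s - (V \<omega> - 1) powr s \<partial>S.S) \<le> (\<integral>\<omega>. s * (V \<omega> - 1) powr (s - 1) \<partial>S.S)"
    proof (rule integral_mono_AE)
      show "AE \<omega> in S.S. V \<omega> powr s - (V \<omega> - 1) powr s \<le> s * (V \<omega> - 1) powr (s - 1)"
        using V_gt by eventually_elim (rule powr_increment_bounds(2)[OF _ s])
    qed (use int_powr int_powr' int_up in auto)
    then show ?thesis by (simp add: diff)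
  qed
qed

end

section \<open>Subordinators along a grid\<close>

text \<open>
  Each \<open>t \<ge> 0\<close> lies in exactly one cell of the grid, so Riemann sums become integrals of step
  functions.
\<close>

lemma suminf_indicator_grid:
  fixes f :: "nat \<Rightarrow> ennreal" and h t :: real
  assumes h: "0 < h"
  shows "(\<Sum>k. f k * indicator {real k * h..<real k * h + h} t)
    = (if 0 \<le> t then f (nat \<lfloor>t / h\<rfloor>) else 0)"
proof -
  have iff: "t \<in> {real k * h..<real k * h + h} \<longleftrightarrow> 0 \<le> t \<and> k = nat \<lfloor>t / h\<rfloor>" for k
  proof -
    have "t \<in> {real k * h..<real k * h + h} \<longleftrightarrow> real k \<le> t / h \<and> t / h < real k + 1"
      using h by (simp add: field_simps)
    also have "\<dots> \<longleftrightarrow> \<lfloor>t / h\<rfloor> = int k" by (simp add: floor_eq_iff)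
    also have "\<dots> \<longleftrightarrow> 0 \<le> t \<and> k = nat \<lfloor>t / h\<rfloor>"
      using h by (auto simp: zero_le_divide_iff) (metis divide_less_0_iff floor_less_zero not_le of_nat_less_0_iff)
    finally show ?thesis .
  qed
  have ind: "indicator {real k * h..<real k * h + h} t = (if 0 \<le> t \<and> k = nat \<lfloor>t / h\<rfloor> then 1 else 0 :: ennreal)" for k
    by (simp only: indicator_def iff of_bool_def)
  show ?thesis
    unfolding ind by (subst suminf_finite[of "{nat \<lfloor>t / h\<rfloor>}"]) auto
qed

lemma riemann_sum_eq_nn_integral:
  fixes f :: "nat \<Rightarrow> ennreal" and h :: real
  assumes h: "0 < h"
  shows "ennreal h * (\<Sum>k. f k) = (\<integral>\<^sup>+t. (if 0 \<le> t then f (nat \<lfloor>t / h\<rfloor>) else 0) \<partial>lborel)"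
proof -
  have "(\<integral>\<^sup>+t. (if 0 \<le> t then f (nat \<lfloor>t / h\<rfloor>) else 0) \<partial>lborel)
      = (\<Sum>k. \<integral>\<^sup>+t. f k * indicator {real k * h..<real k * h + h} t \<partial>lborel)"
    unfolding suminf_indicator_grid[OF h, symmetric] by (rule nn_integral_suminf) measurable
  also have "\<dots> = (\<Sum>k. ennreal h * f k)"
    using h by (simp add: nn_integral_cmult_indicator mult.commute)
  finally show ?thesis by simp
qed

lemma exp_neg_antimono:
  assumes "0 \<le> l" "x \<le> y"
  shows "exp_neg l y \<le> exp_neg l x"
  using assms by (auto simp: exp_neg_def top_unique less_top enn2real_mono intro!: mult_left_mono)

lemma exp_neg_nonneg: "0 \<le> exp_neg l x" by (simp add: exp_neg_def)

lemma exp_neg_le_1: "0 \<le> l \<Longrightarrow> exp_neg l x \<le> 1" by (simp add: exp_neg_def)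

lemma exp_functional_riemann_bounds:
  fixes \<xi> :: "real \<Rightarrow> 'a \<Rightarrow> ennreal" and h :: real
  assumes mono: "mono_on {0..} (\<lambda>t. \<xi> t \<omega>)" and h: "0 < h"
  shows "exp_functional \<xi> \<omega> \<le> ennreal h * (\<Sum>k. ennreal (exp_neg 1 (\<xi> (real k * h) \<omega>)))"
    and "ennreal h * (\<Sum>k. ennreal (exp_neg 1 (\<xi> (real (Suc k) * h) \<omega>))) \<le> exp_functional \<xi> \<omega>"
proof -
  have fl: "real (nat \<lfloor>t / h\<rfloor>) * h \<le> t" "t \<le> real (Suc (nat \<lfloor>t / h\<rfloor>)) * h" if t: "0 \<le> t" for t
  proof -
    have "real (nat \<lfloor>t / h\<rfloor>) = of_int \<lfloor>t / h\<rfloor>" using t h by (simp add: of_nat_nat)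
    then have "real (nat \<lfloor>t / h\<rfloor>) \<le> t / h" "t / h \<le> real (Suc (nat \<lfloor>t / h\<rfloor>))"
      using floor_correct[of "t / h"] by linarith+
    then show "real (nat \<lfloor>t / h\<rfloor>) * h \<le> t" "t \<le> real (Suc (nat \<lfloor>t / h\<rfloor>)) * h"
      using h by (simp_all add: field_simps)
  qed
  have e: "exp_neg 1 (\<xi> t \<omega>) \<le> exp_neg 1 (\<xi> u \<omega>)" if "0 \<le> u" "u \<le> t" for t u
    using that mono_onD[OF mono, of u t] by (intro exp_neg_antimono) auto
  show "exp_functional \<xi> \<omega> \<le> ennreal h * (\<Sum>k. ennreal (exp_neg 1 (\<xi> (real k * h) \<omega>)))"
    unfolding riemann_sum_eq_nn_integral[OF h] exp_functional_def
    using fl h by (intro nn_integral_mono) (auto simp: indicator_def intro!: ennreal_leI e)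
  show "ennreal h * (\<Sum>k. ennreal (exp_neg 1 (\<xi> (real (Suc k) * h) \<omega>))) \<le> exp_functional \<xi> \<omega>"
    unfolding riemann_sum_eq_nn_integral[OF h] exp_functional_def
    using fl by (intro nn_integral_mono) (auto simp: indicator_def intro!: ennreal_leI e)
qed

context subordinator
begin

lemma past_events_subset: "past_events M \<xi> t \<subseteq> Pow (space M)"
  using sigma_sets_into_sp[of "{\<xi> u -` B \<inter> space M | u B. 0 \<le> u \<and> u \<le> t \<and> B \<in> sets borel}" "space M"]
  unfolding past_events_def by blast

lemma sets_past: "sets (sigma (space M) (past_events M \<xi> t)) = past_events M \<xi> t"
  unfolding sets_measure_of[OF past_events_subset]
  unfolding past_events_def by (rule sigma_sets_sigma_sets_eq) auto

lemma measurable_past: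
  assumes u: "0 \<le> u" "u \<le> t"
  shows "\<xi> u \<in> borel_measurable (sigma (space M) (past_events M \<xi> t))"
proof (rule measurableI)
  fix B :: "ennreal set" assume "B \<in> sets borel"
  then show "\<xi> u -` B \<inter> space (sigma (space M) (past_events M \<xi> t))
      \<in> sets (sigma (space M) (past_events M \<xi> t))"
    unfolding sets_past space_measure_of_conv unfolding past_events_def
    using u by (intro sigma_sets.Basic) blast
qed simp

end

text \<open>
  Finiteness at time \<open>1\<close> propagates to all times by the independence of increments.
\<close>

locale unkilled_subordinator = subordinator +
  assumes finite_at_1: "AE \<omega> in M. \<xi> 1 \<omega> < \<infinity>"
begin

declare measurable_process[measurable]

lemma finite_at_nat: "AE \<omega> in M. \<xi> (real n) \<omega> < \<infinity>"
proof (induction n)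
  case 0
  show ?case using starts_at_0 by eventually_elim simp
next
  case (Suc n)
  have "space M \<in> past_events M \<xi> (real n)"
    unfolding past_events_def by (rule sigma_sets_top)
  then have "prob {\<omega> \<in> space M. \<xi> (real n) \<omega> < \<infinity> \<and> \<xi> (real n + 1) \<omega> - \<xi> (real n) \<omega> \<in> {..<\<infinity>}}
      = prob {\<omega> \<in> space M. \<xi> (real n) \<omega> < \<infinity>} * prob {\<omega> \<in> space M. \<xi> 1 \<omega> \<in> {..<\<infinity>}}"
    by (intro increments) auto
  also have "\<dots> = 1"
  proof -
    have "prob {\<omega> \<in> space M. \<xi> (real n) \<omega> < \<infinity>} = 1" using Suc.IH by (subst prob_Collect_eq_1) auto
    moreover have "prob {\<omega> \<in> space M. \<xi> 1 \<omega> \<in> {..<\<infinity>}} = 1"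
      using finite_at_1 by (subst prob_Collect_eq_1) auto
    ultimately show ?thesis by simp
  qed
  finally have "AE \<omega> in M. \<xi> (real n) \<omega> < \<infinity> \<and> \<xi> (real n + 1) \<omega> - \<xi> (real n) \<omega> < \<infinity>"
    by (subst (asm) prob_Collect_eq_1) auto
  then show ?case
    by eventually_elim (auto simp: add.commute ennreal_minus_eq_top less_top[symmetric])
qed

lemma finite_at: assumes "0 \<le> t" shows "AE \<omega> in M. \<xi> t \<omega> < \<infinity>"
proof -
  obtain n where n: "t \<le> real n" using real_arch_simple by blast
  show ?thesis using finite_at_nat[of n] AE_space
  proof eventually_elim
    case (elim \<omega>)
    then show ?case using mono_onD[OF mono_paths[of \<omega>], of t "real n"] n assms by (auto simp: le_less_trans)
  qed
qed

definition step :: "real \<Rightarrow> nat \<Rightarrow> 'a \<Rightarrow> real" where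
  "step h k \<omega> = enn2real (\<xi> (real k * h + h) \<omega> - \<xi> (real k * h) \<omega>)"

definition step_law :: "real \<Rightarrow> real measure" where
  "step_law h = distr M borel (\<lambda>\<omega>. enn2real (\<xi> h \<omega>))"

lemma iid_steps_step_law: "0 \<le> h \<Longrightarrow> iid_steps (step_law h)"
  unfolding step_law_def iid_steps_def by (intro real_distribution_distr) measurable

lemma measurable_step: "0 \<le> h \<Longrightarrow> step h k \<in> borel_measurable M"
  unfolding step_def by measurable

text \<open>
  Induction on the number of steps: the first \<open>N\<close> steps are determined by the past up to time
  \<open>N * h\<close>, to which the independence and stationarity of increments apply.
\<close>

lemma prob_steps:
  assumes h: "0 \<le> h" and B: "\<And>j. B j \<in> sets borel"
  shows "prob {\<omega> \<in> space M. \<forall>j<N. step h j \<omega> \<in> B j} = (\<Prod>j<N. measure (step_law h) (B j))"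
proof (induction N)
  case 0
  then show ?case by (simp add: prob_space)
next
  case (Suc N)
  note B[measurable]
  define t where "t = real N * h"
  define A where "A = {\<omega> \<in> space M. \<forall>j<N. step h j \<omega> \<in> B j}"
  have t: "0 \<le> t" using h by (simp add: t_def)
  have A_past: "A \<in> past_events M \<xi> t"
  proof -
    let ?F = "sigma (space M) (past_events M \<xi> t)"
    have [measurable]: "step h j \<in> borel_measurable ?F" if "j < N" for j
    proof -
      have "real j * h + h \<le> t"
        using that h mult_right_mono[of "real j + 1" "real N" h] by (simp add: t_def distrib_right)
      then have "\<xi> (real j * h + h) \<in> borel_measurable ?F" "\<xi> (real j * h) \<in> borel_measurable ?F"
        using h by (auto intro!: measurable_past)
      then show ?thesis unfolding step_def by measurable
    qed
    have "{\<omega> \<in> space ?F. \<forall>j\<in>{..<N}. step h j \<omega> \<in> B j} \<in> sets ?F" by measurable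
    then show ?thesis by (simp add: sets_past A_def space_measure_of_conv Ball_def)
  qed
  have [measurable]: "A \<in> sets M"
    unfolding A_def using measurable_step[OF h, measurable] by measurable
  have [measurable]: "\<xi> t \<in> borel_measurable M" "\<xi> (t + h) \<in> borel_measurable M"
    using t h by (auto intro: measurable_process)
  have "prob {\<omega> \<in> space M. \<forall>j<Suc N. step h j \<omega> \<in> B j}
      = prob {\<omega> \<in> A. \<xi> t \<omega> < \<infinity> \<and> \<xi> (t + h) \<omega> - \<xi> t \<omega> \<in> enn2real -` B N}"
  proof (rule measure_eq_AE)
    show "AE \<omega> in M. (\<omega> \<in> {\<omega> \<in> space M. \<forall>j<Suc N. step h j \<omega> \<in> B j})
        \<longleftrightarrow> (\<omega> \<in> {\<omega> \<in> A. \<xi> t \<omega> < \<infinity> \<and> \<xi> (t + h) \<omega> - \<xi> t \<omega> \<in> enn2real -` B N})"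
      using finite_at[OF t] by eventually_elim (auto simp: A_def step_def t_def less_Suc_eq)
    show "{\<omega> \<in> space M. \<forall>j<Suc N. step h j \<omega> \<in> B j} \<in> sets M"
      using measurable_step[OF h, measurable] by measurable
    have "A \<inter> {\<omega> \<in> space M. \<xi> t \<omega> < \<infinity> \<and> enn2real (\<xi> (t + h) \<omega> - \<xi> t \<omega>) \<in> B N} \<in> sets M"
      by measurable
    moreover have "A \<inter> {\<omega> \<in> space M. \<xi> t \<omega> < \<infinity> \<and> enn2real (\<xi> (t + h) \<omega> - \<xi> t \<omega>) \<in> B N}
        = {\<omega> \<in> A. \<xi> t \<omega> < \<infinity> \<and> \<xi> (t + h) \<omega> - \<xi> t \<omega> \<in> enn2real -` B N}"
      by (auto simp: A_def)
    ultimately show "{\<omega> \<in> A. \<xi> t \<omega> < \<infinity> \<and> \<xi> (t + h) \<omega> - \<xi> t \<omega> \<in> enn2real -` B N} \<in> sets M" by simp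
  qed
  also have "\<dots> = prob {\<omega> \<in> A. \<xi> t \<omega> < \<infinity>} * prob {\<omega> \<in> space M. \<xi> h \<omega> \<in> enn2real -` B N}"
    using measurable_sets[OF borel_measurable_enn2real[OF measurable_ident] B[of N]]
    by (intro increments t h A_past) simp
  also have "prob {\<omega> \<in> A. \<xi> t \<omega> < \<infinity>} = prob A"
  proof (rule measure_eq_AE)
    show "AE \<omega> in M. (\<omega> \<in> {\<omega> \<in> A. \<xi> t \<omega> < \<infinity>}) \<longleftrightarrow> \<omega> \<in> A"
      using finite_at[OF t] by eventually_elim auto
    have "A \<inter> {\<omega> \<in> space M. \<xi> t \<omega> < \<infinity>} \<in> sets M" by measurable
    moreover have "A \<inter> {\<omega> \<in> space M. \<xi> t \<omega> < \<infinity>} = {\<omega> \<in> A. \<xi> t \<omega> < \<infinity>}" by (auto simp: A_def)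
    ultimately show "{\<omega> \<in> A. \<xi> t \<omega> < \<infinity>} \<in> sets M" by simp
  qed measurable
  also have "prob {\<omega> \<in> space M. \<xi> h \<omega> \<in> enn2real -` B N} = measure (step_law h) (B N)"
    unfolding step_law_def using h by (subst measure_distr) (auto simp: vimage_def Int_def conj_commute)
  finally show ?case using Suc.IH by (simp add: A_def)
qed

text \<open>
  A law on sequences is determined by its finite-dimensional marginals.
\<close>

lemma distr_steps:
  assumes h: "0 \<le> h"
  shows "distr M (\<Pi>\<^sub>M k\<in>UNIV. borel) (\<lambda>\<omega> k. step h k \<omega>) = (\<Pi>\<^sub>M k\<in>UNIV. step_law h)"
proof -
  interpret R: iid_steps "step_law h" by (rule iid_steps_step_law[OF h])
  have X[measurable]: "(\<lambda>\<omega> k. step h k \<omega>) \<in> measurable M (\<Pi>\<^sub>M k\<in>(UNIV :: nat set). borel)"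
    by (rule measurable_PiM_single') (auto intro: measurable_step[OF h])
  show ?thesis
  proof (rule R.S.PiM_eq)
    show sets_eq: "sets (distr M (\<Pi>\<^sub>M k\<in>(UNIV :: nat set). borel) (\<lambda>\<omega> k. step h k \<omega>))
        = sets (\<Pi>\<^sub>M k\<in>UNIV. step_law h)"
      unfolding sets_distr by (rule sets_PiM_cong) (auto simp: step_law_def)
    fix J :: "nat set" and F assume J: "finite J" and F: "\<And>j. j \<in> J \<Longrightarrow> F j \<in> sets (step_law h)"
    obtain N where N: "J \<subseteq> {..<N}" using J finite_nat_iff_bounded by blast
    define B where "B j = (if j \<in> J then F j else UNIV)" for j
    have B: "B j \<in> sets borel" for j using F by (auto simp: B_def step_law_def)
    let ?E = "prod_emb UNIV (\<lambda>_. step_law h) J (\<Pi>\<^sub>E j\<in>J. F j)"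
    have E: "?E \<in> sets (\<Pi>\<^sub>M k\<in>(UNIV :: nat set). borel)"
      using sets_PiM_I[of J UNIV F "\<lambda>_. step_law h"] J F sets_eq by simp
    have "emeasure (distr M (\<Pi>\<^sub>M k\<in>UNIV. borel) (\<lambda>\<omega> k. step h k \<omega>)) ?E
        = emeasure M {\<omega> \<in> space M. \<forall>j<N. step h j \<omega> \<in> B j}"
      using E subsetD[OF N] by (subst emeasure_distr[OF X]) (auto intro!: arg_cong[of _ _ "emeasure M"]
        simp: prod_emb_def B_def PiE_iff step_law_def space_PiM split: if_splits)
    also have "\<dots> = ennreal (\<Prod>j<N. measure (step_law h) (B j))"
      unfolding emeasure_eq_measure prob_steps[OF h B] ..
    also have "(\<Prod>j<N. measure (step_law h) (B j)) = (\<Prod>j\<in>J. measure (step_law h) (F j))"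
      using N R.prob_space by (intro prod.mono_neutral_cong_right) (auto simp: B_def step_law_def)
    also have "ennreal \<dots> = (\<Prod>j\<in>J. emeasure (step_law h) (F j))"
      by (simp add: R.emeasure_eq_measure prod_ennreal)
    finally show "emeasure (distr M (\<Pi>\<^sub>M k\<in>UNIV. borel) (\<lambda>\<omega> k. step h k \<omega>)) ?E
        = (\<Prod>j\<in>J. emeasure (step_law h) (F j))" .
  qed
qed

text \<open>
  Subtraction of extended nonnegative values telescopes only where they are finite, hence almost surely.
\<close>

lemma partial_sum_steps:
  assumes h: "0 \<le> h"
  shows "AE \<omega> in M. \<forall>k. ennreal (\<Sum>j<k. step h j \<omega>) = \<xi> (real k * h) \<omega>"
proof -
  have "AE \<omega> in M. \<forall>k. \<xi> (real k * h) \<omega> < \<infinity>"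
    using h finite_at by (simp add: AE_all_countable)
  then show ?thesis using starts_at_0 AE_space
  proof eventually_elim
    case (elim \<omega>)
    show ?case
    proof
      fix k
      show "ennreal (\<Sum>j<k. step h j \<omega>) = \<xi> (real k * h) \<omega>"
      proof (induction k)
        case 0
        then show ?case using elim by simp
      next
        case (Suc k)
        have le: "\<xi> (real k * h) \<omega> \<le> \<xi> (real k * h + h) \<omega>"
          using h elim(3) by (intro mono_onD[OF mono_paths]) auto
        have "\<xi> (real k * h + h) \<omega> < \<infinity>" using elim(1)[rule_format, of "Suc k"] by (simp add: algebra_simps)
        then have "ennreal (step h k \<omega>) = \<xi> (real k * h + h) \<omega> - \<xi> (real k * h) \<omega>"
          unfolding step_def by (intro ennreal_enn2real) (auto simp: ennreal_minus_eq_top less_top[symmetric])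
        then have "ennreal (\<Sum>j<Suc k. step h j \<omega>)
            = \<xi> (real k * h) \<omega> + (\<xi> (real k * h + h) \<omega> - \<xi> (real k * h) \<omega>)"
          using Suc.IH by (simp add: ennreal_plus sum_nonneg step_def)
        also have "\<dots> = \<xi> (real (Suc k) * h) \<omega>"
          using diff_add_cancel_ennreal[OF le] by (simp add: algebra_simps)
        finally show ?case .
      qed
    qed
  qed
qed

definition grid_sum :: "real \<Rightarrow> 'a \<Rightarrow> ennreal" where
  "grid_sum h \<omega> = (\<Sum>k. ennreal (exp_neg 1 (\<xi> (real k * h) \<omega>)))"

lemma measurable_grid_sum: "0 \<le> h \<Longrightarrow> grid_sum h \<in> borel_measurable M"
  unfolding grid_sum_def exp_neg_def by measurable

lemma grid_sum_eq_perpetuity: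
  assumes h: "0 \<le> h"
  shows "AE \<omega> in M. grid_sum h \<omega> = perpetuity (\<lambda>k. step h k \<omega>)"
  using partial_sum_steps[OF h]
proof eventually_elim
  case (elim \<omega>)
  have "exp_neg 1 (\<xi> (real k * h) \<omega>) = exp (- (\<Sum>j<k. step h j \<omega>))" for k
    unfolding elim[rule_format, symmetric] by (simp add: exp_neg_def sum_nonneg step_def)
  then show ?case by (simp add: grid_sum_def perpetuity_def)
qed

lemma measurable_steps:
  "0 \<le> h \<Longrightarrow> (\<lambda>\<omega> k. step h k \<omega>) \<in> measurable M (\<Pi>\<^sub>M k\<in>(UNIV :: nat set). borel)"
  by (rule measurable_PiM_single') (auto intro: measurable_step)

lemma integral_grid_sum:
  fixes g :: "ennreal \<Rightarrow> real"
  assumes h: "0 \<le> h" and g[measurable]: "g \<in> borel_measurable borel"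
  shows "(\<integral>\<omega>. g (grid_sum h \<omega>) \<partial>M) = (\<integral>x. g (perpetuity x) \<partial>(\<Pi>\<^sub>M k\<in>UNIV. step_law h))"
    and "integrable M (\<lambda>\<omega>. g (grid_sum h \<omega>)) \<longleftrightarrow> integrable (\<Pi>\<^sub>M k\<in>UNIV. step_law h) (\<lambda>x. g (perpetuity x))"
proof -
  note [measurable] = measurable_grid_sum[OF h] measurable_steps[OF h]
  have [measurable]: "perpetuity \<in> borel_measurable (\<Pi>\<^sub>M k\<in>(UNIV :: nat set). borel)"
    unfolding perpetuity_def by measurable
  show "(\<integral>\<omega>. g (grid_sum h \<omega>) \<partial>M) = (\<integral>x. g (perpetuity x) \<partial>(\<Pi>\<^sub>M k\<in>UNIV. step_law h))"
    unfolding distr_steps[OF h, symmetric]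
    by (subst integral_distr, measurable, rule integral_cong_AE)
       (use grid_sum_eq_perpetuity[OF h] in \<open>measurable, eventually_elim, simp\<close>)
  show "integrable M (\<lambda>\<omega>. g (grid_sum h \<omega>)) \<longleftrightarrow> integrable (\<Pi>\<^sub>M k\<in>UNIV. step_law h) (\<lambda>x. g (perpetuity x))"
    unfolding distr_steps[OF h, symmetric]
    by (subst integrable_distr_eq, measurable, rule integrable_cong_AE)
       (use grid_sum_eq_perpetuity[OF h] in \<open>measurable, eventually_elim, simp\<close>)
qed

lemma nn_integral_grid_sum:
  assumes h: "0 \<le> h"
  shows "(\<integral>\<^sup>+\<omega>. grid_sum h \<omega> \<partial>M) = (\<integral>\<^sup>+x. perpetuity x \<partial>(\<Pi>\<^sub>M k\<in>UNIV. step_law h))"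
proof -
  have [measurable]: "perpetuity \<in> borel_measurable (\<Pi>\<^sub>M k\<in>(UNIV :: nat set). borel)"
    unfolding perpetuity_def by measurable
  show ?thesis
    unfolding distr_steps[OF h, symmetric]
    by (subst nn_integral_distr[OF measurable_steps[OF h]], measurable, rule nn_integral_cong_AE)
       (rule grid_sum_eq_perpetuity[OF h])
qed

lemma integrable_exp_neg_step_law:
  assumes "0 \<le> h" "0 \<le> s"
  shows "integrable (step_law h) (\<lambda>x. exp (- s * x))"
proof -
  have "integrable M (\<lambda>\<omega>. exp (- s * enn2real (\<xi> h \<omega>)))"
    by (rule integrable_const_bound[of _ 1]) (use assms in \<open>auto intro: mult_nonneg_nonneg\<close>)
  then show ?thesis
    unfolding step_law_def using assms by (subst integrable_distr_eq) auto
qed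

text \<open>
  The value at time \<open>n * h\<close> is a sum of \<open>n\<close> independent steps. With \<open>h = 1 / n\<close> this determines the
  Laplace transform of one step from that of the process at time \<open>1\<close>.
\<close>

lemma laplace_transform_grid:
  assumes "0 \<le> h" "0 \<le> s"
  shows "(\<integral>\<omega>. exp (- s * enn2real (\<xi> (real n * h) \<omega>)) \<partial>M) = (\<integral>x. exp (- s * x) \<partial>step_law h) ^ n"
proof -
  interpret R: iid_steps "step_law h" by (rule iid_steps_step_law[OF assms(1)])
  note [measurable] = measurable_steps[OF assms(1)]
  have int: "integrable M (\<lambda>\<omega>. exp (- s * enn2real (\<xi> (real n * h) \<omega>)))"
    by (rule integrable_const_bound[of _ 1]) (use assms in \<open>auto intro: mult_nonneg_nonneg\<close>)
  have "ennreal (\<integral>\<omega>. exp (- s * enn2real (\<xi> (real n * h) \<omega>)) \<partial>M)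
      = (\<integral>\<^sup>+\<omega>. ennreal (exp (- s * enn2real (\<xi> (real n * h) \<omega>))) \<partial>M)"
    by (rule nn_integral_eq_integral[OF int, symmetric]) simp
  also have "\<dots> = (\<integral>\<^sup>+\<omega>. ennreal (exp (- s * (\<Sum>j<n. step h j \<omega>))) \<partial>M)"
  proof (rule nn_integral_cong_AE)
    show "AE \<omega> in M. ennreal (exp (- s * enn2real (\<xi> (real n * h) \<omega>)))
        = ennreal (exp (- s * (\<Sum>j<n. step h j \<omega>)))"
      using partial_sum_steps[OF assms(1)]
    proof eventually_elim
      case (elim \<omega>)
      show ?case unfolding elim[rule_format, symmetric] by (simp add: sum_nonneg step_def)
    qed
  qed
  also have "\<dots> = (\<integral>\<^sup>+x. ennreal (exp (- s * (\<Sum>j<n. x j))) \<partial>(\<Pi>\<^sub>M k\<in>UNIV. step_law h))"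
    unfolding distr_steps[OF assms(1), symmetric] by (subst nn_integral_distr) measurable
  also have "\<dots> = ennreal (\<integral>x. exp (- s * x) \<partial>step_law h) ^ n"
    unfolding R.nn_integral_exp_partial_sum
    by (simp only: nn_integral_eq_integral[OF integrable_exp_neg_step_law[OF assms]] exp_ge_zero AE_I2)
  finally show ?thesis by (simp add: ennreal_power)
qed

end

section \<open>The Mellin transform of the exponential functional\<close>

text \<open>
  A single majorant for powers of both signs: a lower bound on \<open>u\<close> controls the negative powers, an upper
  bound the powers between \<open>0\<close> and \<open>1\<close>.
\<close>

lemma powr_le_of_bounds:
  fixes u y i p :: real
  assumes "exp (- y) \<le> u" "u \<le> i + 1" "0 \<le> i" "p \<le> 1"
  shows "u powr p \<le> exp (- p * y) + (2 + i)"
proof (cases "p \<le> 0")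
  case True
  have "u powr p \<le> exp (- y) powr p" using assms True by (intro powr_mono2') auto
  also have "\<dots> = exp (- p * y)" by (simp add: exp_powr_real mult.commute)
  finally show ?thesis using assms by simp
next
  case False
  have u: "0 < u" using assms(1) exp_gt_zero[of "- y"] by linarith
  have "u powr p \<le> max 1 u"
  proof (cases "u \<le> 1")
    case True
    then show ?thesis using False u powr_le1[of p u] by simp
  next
    case u1: False
    then have "u powr p \<le> u powr 1" using assms(4) by (intro powr_mono) auto
    then show ?thesis using u by simp
  qed
  then show ?thesis using assms by (smt (verit) exp_gt_zero)
qed

locale bounded_jump_subordinator =
  unkilled_subordinator M \<xi> + bounded_jump_measure a c \<Lambda>
  for M :: "'a measure" and \<xi> :: "real \<Rightarrow> 'a \<Rightarrow> ennreal" and a c \<Lambda> +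
  assumes laplace: "\<And>l. 0 \<le> l \<Longrightarrow> (\<integral>\<omega>. exp (- l * enn2real (\<xi> 1 \<omega>)) \<partial>M) = exp (- exponent l)"
begin

definition I :: "'a \<Rightarrow> real" where "I \<omega> = enn2real (exp_functional \<xi> \<omega>)"

definition Y :: "'a \<Rightarrow> real" where "Y \<omega> = enn2real (\<xi> 1 \<omega>)"

lemma measurable_Y[measurable]: "Y \<in> borel_measurable M"
  unfolding Y_def by measurable

text \<open>
  The entire extension of the Laplace transform of \<open>\<xi> 1\<close> is \<open>exp (- \<phi>)\<close>.
\<close>

lemma exponential_moments_Y: "integrable M (\<lambda>\<omega>. exp (s * Y \<omega>))"
proof (rule exponential_moments_of_entire_laplace_transform)
  show "(\<lambda>z. exp (- (ratio z * z))) holomorphic_on UNIV"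
    by (intro holomorphic_intros exponent_quotient_holomorphic)
  show "exp (- (ratio (of_real l) * of_real l)) = of_real (\<integral>\<omega>. exp (- l * Y \<omega>) \<partial>M)" if "0 < l" for l
  proof -
    have "ratio (of_real l) * of_real l = of_real (exponent l)"
      using that by (simp add: exponent_quotient_of_real)
    then have "exp (- (ratio (of_real l) * of_real l)) = of_real (exp (- exponent l))"
      by (simp add: exp_of_real flip: of_real_minus)
    then show ?thesis using laplace[of l] that by (simp add: Y_def)
  qed
qed (auto simp: Y_def)

text \<open>
  The left Riemann sum of the decreasing function \<open>exp (- \<xi>)\<close> exceeds the right one by at most the mesh,
  and the integral lies between them.
\<close>

lemma grid_sum_bounds:
  assumes \<omega>: "\<omega> \<in> space M" and h: "0 < h"
  shows "exp_functional \<xi> \<omega> \<le> ennreal h * grid_sum h \<omega>"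
    and "ennreal h * grid_sum h \<omega> \<le> ennreal h + exp_functional \<xi> \<omega>"
proof -
  note b = exp_functional_riemann_bounds[where \<xi> = \<xi> and \<omega> = \<omega>, OF mono_paths[OF \<omega>] h]
  show "exp_functional \<xi> \<omega> \<le> ennreal h * grid_sum h \<omega>"
    using b(1) by (simp add: grid_sum_def)
  have "grid_sum h \<omega> = ennreal (exp_neg 1 (\<xi> 0 \<omega>)) + (\<Sum>k. ennreal (exp_neg 1 (\<xi> (real (Suc k) * h) \<omega>)))"
    unfolding grid_sum_def
    using suminf_offset[OF summableI, of "\<lambda>k. ennreal (exp_neg 1 (\<xi> (real k * h) \<omega>))" 1]
    by (simp add: add.commute)
  also have "\<dots> \<le> 1 + (\<Sum>k. ennreal (exp_neg 1 (\<xi> (real (Suc k) * h) \<omega>)))"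
    using exp_neg_le_1[of 1 "\<xi> 0 \<omega>"] by (intro add_right_mono) (simp flip: ennreal_1 add: ennreal_leI del: ennreal_1)
  finally have "ennreal h * grid_sum h \<omega> \<le> ennreal h * (1 + (\<Sum>k. ennreal (exp_neg 1 (\<xi> (real (Suc k) * h) \<omega>))))"
    by (rule mult_left_mono) simp
  also have "\<dots> \<le> ennreal h + exp_functional \<xi> \<omega>"
    using b(2) by (simp add: distrib_left)
  finally show "ennreal h * grid_sum h \<omega> \<le> ennreal h + exp_functional \<xi> \<omega>" .
qed

text \<open>
  After the first one, the next \<open>n\<close> terms of the sum belong to times up to \<open>1\<close>, and each is at least
  \<open>exp (- \<xi> 1)\<close>. So the right Riemann sums of all meshes \<open>1 / n\<close> share one lower bound, which
  provides the majorant for their negative powers.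
\<close>

lemma grid_sum_lower:
  assumes \<omega>: "\<omega> \<in> space M" and n: "0 < n"
  shows "ennreal (1 / real n) * ennreal (exp_neg 1 (\<xi> 0 \<omega>)) + ennreal (exp_neg 1 (\<xi> 1 \<omega>))
    \<le> ennreal (1 / real n) * grid_sum (1 / real n) \<omega>"
proof -
  have "ennreal (exp_neg 1 (\<xi> 1 \<omega>)) \<le> ennreal (exp_neg 1 (\<xi> (real k * (1 / real n)) \<omega>))" if "k \<le> n" for k
    using that n by (intro ennreal_leI exp_neg_antimono mono_onD[OF mono_paths[OF \<omega>]]) auto
  then have "(\<Sum>k\<in>{1..n}. ennreal (exp_neg 1 (\<xi> 1 \<omega>)))
      \<le> (\<Sum>k\<in>{1..n}. ennreal (exp_neg 1 (\<xi> (real k * (1 / real n)) \<omega>)))"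
    by (intro sum_mono) auto
  then have "ennreal (exp_neg 1 (\<xi> 0 \<omega>)) + of_nat n * ennreal (exp_neg 1 (\<xi> 1 \<omega>))
      \<le> (\<Sum>k\<in>{0..n}. ennreal (exp_neg 1 (\<xi> (real k * (1 / real n)) \<omega>)))"
    by (subst sum.atLeast_Suc_atMost) (auto intro!: add_left_mono)
  also have "\<dots> \<le> grid_sum (1 / real n) \<omega>"
    unfolding grid_sum_def by (intro sum_le_suminf summableI) auto
  finally have "ennreal (1 / real n) * (ennreal (exp_neg 1 (\<xi> 0 \<omega>)) + of_nat n * ennreal (exp_neg 1 (\<xi> 1 \<omega>)))
      \<le> ennreal (1 / real n) * grid_sum (1 / real n) \<omega>"
    by (rule mult_left_mono) simp
  moreover have "ennreal (1 / real n) * (of_nat n * ennreal (exp_neg 1 (\<xi> 1 \<omega>))) = ennreal (exp_neg 1 (\<xi> 1 \<omega>))"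
    using n by (simp add: mult.assoc[symmetric] ennreal_of_nat_eq_real_of_nat ennreal_mult[symmetric])
  ultimately show ?thesis by (simp add: distrib_left)
qed

lemma measurable_exp_functional[measurable]: "exp_functional \<xi> \<in> borel_measurable M"
proof (rule borel_measurable_LIMSEQ_order)
  show "(\<lambda>\<omega>. ennreal (1 / real (Suc n)) * grid_sum (1 / real (Suc n)) \<omega>) \<in> borel_measurable M" for n
    using measurable_grid_sum[of "1 / real (Suc n)"] by simp
  fix \<omega> assume \<omega>: "\<omega> \<in> space M"
  have "(\<lambda>n. ennreal (1 / real (Suc n)) + exp_functional \<xi> \<omega>) \<longlonglongrightarrow> ennreal 0 + exp_functional \<xi> \<omega>"
    by (intro tendsto_add tendsto_ennrealI tendsto_const) real_asymp
  then have upper: "(\<lambda>n. ennreal (1 / real (Suc n)) + exp_functional \<xi> \<omega>) \<longlonglongrightarrow> exp_functional \<xi> \<omega>"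
    by simp
  show "(\<lambda>n. ennreal (1 / real (Suc n)) * grid_sum (1 / real (Suc n)) \<omega>) \<longlonglongrightarrow> exp_functional \<xi> \<omega>"
    by (rule tendsto_sandwich[OF _ _ tendsto_const[of "exp_functional \<xi> \<omega>"] upper])
       (use grid_sum_bounds[OF \<omega>] in \<open>simp_all\<close>)
qed

lemma measurable_I[measurable]: "I \<in> borel_measurable M"
  unfolding I_def by measurable

lemma nn_integral_grid_sum_finite:
  assumes n: "0 < n"
  shows "(\<integral>\<^sup>+\<omega>. grid_sum (1 / real n) \<omega> \<partial>M) < \<infinity>"
    and "(\<integral>\<^sup>+x. perpetuity x \<partial>(\<Pi>\<^sub>M k\<in>UNIV. step_law (1 / real n))) < \<infinity>"
proof -
  interpret R: iid_steps "step_law (1 / real n)" by (rule iid_steps_step_law) simp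
  define m where "m = (\<integral>x. exp (- 1 * x) \<partial>step_law (1 / real n))"
  have "m ^ n = exp (- exponent 1)"
    using laplace_transform_grid[of "1 / real n" 1 n] laplace[of 1] n by (simp add: m_def)
  then have "m ^ n < 1" using exponent_pos[of 1] by simp
  then have m: "m < 1" using one_le_power[of m n] by linarith
  have "(\<integral>\<^sup>+x. ennreal (exp (- x)) \<partial>step_law (1 / real n)) = ennreal m"
    using integrable_exp_neg_step_law[of "1 / real n" 1]
    by (subst nn_integral_eq_integral) (auto simp: m_def)
  then show *: "(\<integral>\<^sup>+x. perpetuity x \<partial>(\<Pi>\<^sub>M k\<in>UNIV. step_law (1 / real n))) < \<infinity>"
    using m by (intro R.nn_integral_perpetuity_finite) (simp add: ennreal_lessI flip: ennreal_1)
  then show "(\<integral>\<^sup>+\<omega>. grid_sum (1 / real n) \<omega> \<partial>M) < \<infinity>" by (simp add: nn_integral_grid_sum)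
qed

lemma nn_integral_exp_functional_finite: "(\<integral>\<^sup>+\<omega>. exp_functional \<xi> \<omega> \<partial>M) < \<infinity>"
proof -
  have "(\<integral>\<^sup>+\<omega>. exp_functional \<xi> \<omega> \<partial>M) \<le> (\<integral>\<^sup>+\<omega>. grid_sum 1 \<omega> \<partial>M)"
    using grid_sum_bounds(1)[of _ 1] by (intro nn_integral_mono) simp
  also have "\<dots> < \<infinity>" using nn_integral_grid_sum_finite(1)[of 1] by simp
  finally show ?thesis .
qed

lemma exp_functional_finite: "AE \<omega> in M. exp_functional \<xi> \<omega> = ennreal (I \<omega>)"
proof -
  have "AE \<omega> in M. exp_functional \<xi> \<omega> \<noteq> \<infinity>"
    using nn_integral_exp_functional_finite by (intro nn_integral_PInf_AE) auto
  then show ?thesis by eventually_elim (simp add: I_def ennreal_enn2real_if)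
qed

lemma integrable_I: "integrable M I"
proof (rule integrableI_bounded)
  have "(\<integral>\<^sup>+\<omega>. ennreal (norm (I \<omega>)) \<partial>M) = (\<integral>\<^sup>+\<omega>. exp_functional \<xi> \<omega> \<partial>M)"
    by (rule nn_integral_cong_AE) (use exp_functional_finite in \<open>eventually_elim, simp add: I_def\<close>)
  then show "(\<integral>\<^sup>+\<omega>. ennreal (norm (I \<omega>)) \<partial>M) < \<infinity>"
    using nn_integral_exp_functional_finite by simp
qed measurable

lemma grid_sum_approximation:
  assumes n: "0 < n"
  shows "AE \<omega> in M. I \<omega> \<le> enn2real (grid_sum (1 / real n) \<omega>) / real n
    \<and> enn2real (grid_sum (1 / real n) \<omega>) / real n \<le> I \<omega> + 1 / real n
    \<and> exp (- Y \<omega>) \<le> enn2real (grid_sum (1 / real n) \<omega>) / real n - 1 / real n"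
  using exp_functional_finite finite_at_1 starts_at_0 AE_space
proof eventually_elim
  case (elim \<omega>)
  define g where "g = grid_sum (1 / real n) \<omega>"
  have I0: "0 \<le> I \<omega>" by (simp add: I_def)
  have up: "ennreal (1 / real n) * g \<le> ennreal (1 / real n + I \<omega>)"
    using grid_sum_bounds(2)[OF elim(4), of "1 / real n"] n I0 elim(1) by (simp add: g_def ennreal_plus)
  have "g \<noteq> \<top>"
  proof
    assume "g = \<top>"
    then show False using up n by (simp add: ennreal_mult_top top_unique)
  qed
  then obtain r where r: "g = ennreal r" "0 \<le> r" by (cases g) auto
  have scaled: "ennreal (1 / real n) * g = ennreal (r / real n)"
    using r ennreal_mult[of "1 / real n" r] by simp
  have "ennreal (r / real n) \<le> ennreal (1 / real n + I \<omega>)"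
    using up unfolding scaled .
  then have 1: "r / real n \<le> I \<omega> + 1 / real n" using I0 by (subst (asm) ennreal_le_iff) auto
  have "ennreal (I \<omega>) \<le> ennreal (r / real n)"
    using grid_sum_bounds(1)[OF elim(4), of "1 / real n"] n unfolding elim(1) scaled[unfolded g_def] by simp
  then have 2: "I \<omega> \<le> r / real n" using r(2) by (subst (asm) ennreal_le_iff) auto
  have "exp_neg 1 (\<xi> 0 \<omega>) = 1" "exp_neg 1 (\<xi> 1 \<omega>) = exp (- Y \<omega>)"
    using elim(2,3) by (simp_all add: exp_neg_def Y_def less_top)
  then have "ennreal (1 / real n + exp (- Y \<omega>)) \<le> ennreal (r / real n)"
    using grid_sum_lower[OF elim(4) n] unfolding scaled[unfolded g_def] by (simp add: ennreal_plus)
  then have 3: "exp (- Y \<omega>) \<le> r / real n - 1 / real n" using r(2) by (subst (asm) ennreal_le_iff) auto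
  show ?case using 1 2 3 r by (simp add: g_def)
qed

lemma exp_neg_Y_le_I: "AE \<omega> in M. exp (- Y \<omega>) \<le> I \<omega>"
  using grid_sum_approximation[OF zero_less_one] by eventually_elim simp

lemma integral_powr_tendsto:
  fixes U :: "nat \<Rightarrow> 'a \<Rightarrow> real"
  assumes [measurable]: "\<And>n. U n \<in> borel_measurable M"
    and bounds: "AE \<omega> in M. \<forall>n. exp (- Y \<omega>) \<le> U n \<omega> \<and> U n \<omega> \<le> I \<omega> + 1"
    and lim: "AE \<omega> in M. (\<lambda>n. U n \<omega>) \<longlonglongrightarrow> I \<omega>" and p: "p \<le> 1"
  shows "integrable M (\<lambda>\<omega>. I \<omega> powr p)" and "integrable M (\<lambda>\<omega>. U n \<omega> powr p)"
    and "(\<lambda>n. \<integral>\<omega>. U n \<omega> powr p \<partial>M) \<longlonglongrightarrow> (\<integral>\<omega>. I \<omega> powr p \<partial>M)"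
proof -
  have dom: "integrable M (\<lambda>\<omega>. exp (- p * Y \<omega>) + (2 + I \<omega>))"
    by (intro Bochner_Integration.integrable_add integrable_I exponential_moments_Y) simp
  have "AE \<omega> in M. (\<lambda>n. U n \<omega> powr p) \<longlonglongrightarrow> I \<omega> powr p"
    using lim exp_neg_Y_le_I
  proof eventually_elim
    case (elim \<omega>)
    then have "I \<omega> \<noteq> 0" using exp_gt_zero[of "- Y \<omega>"] by linarith
    then show ?case using elim by (intro tendsto_powr tendsto_const) auto
  qed
  note lim_powr = this
  have bound: "AE \<omega> in M. norm (U n \<omega> powr p) \<le> exp (- p * Y \<omega>) + (2 + I \<omega>)" for n
    using bounds
  proof eventually_elim
    case (elim \<omega>)
    have "0 \<le> I \<omega>" by (simp add: I_def)
    then show ?case using powr_le_of_bounds[of "Y \<omega>" "U n \<omega>" "I \<omega>" p] elim p by simp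
  qed
  note dc = dom lim_powr bound
  show "integrable M (\<lambda>\<omega>. I \<omega> powr p)" by (rule integrable_dominated_convergence[OF _ _ dc]) measurable
  show "integrable M (\<lambda>\<omega>. U n \<omega> powr p)" by (rule integrable_dominated_convergence2[OF _ _ dc]) measurable
  show "(\<lambda>n. \<integral>\<omega>. U n \<omega> powr p \<partial>M) \<longlonglongrightarrow> (\<integral>\<omega>. I \<omega> powr p \<partial>M)"
    by (rule integral_dominated_convergence[OF _ _ dc]) measurable
qed

lemma integrable_I_powr: "p \<le> 1 \<Longrightarrow> integrable M (\<lambda>\<omega>. I \<omega> powr p)"
  by (rule integral_powr_tendsto(1)[of "\<lambda>_. I"]) (use exp_neg_Y_le_I in \<open>auto elim: eventually_mono\<close>)

text \<open>
  The limit of \<open>perpetuity_moment_bounds\<close> for meshes tending to \<open>0\<close>. The left Riemann sums \<open>V\<close> and the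
  right ones \<open>V - h\<close> both converge to \<open>I\<close>, between \<open>exp (- Y)\<close> and \<open>I + 1\<close>, so their moments converge;
  the factor \<open>(1 - m) / h\<close> converges to the exponent because \<open>m = exp (- exponent s * h)\<close>.
\<close>

lemma functional_equation_real:
  assumes s: "0 < s" "s < 1"
  shows "s * (\<integral>\<omega>. I \<omega> powr (s - 1) \<partial>M) = exponent s * (\<integral>\<omega>. I \<omega> powr s \<partial>M)"
proof -
  define h where "h n = 1 / real (Suc n)" for n
  define V where "V n \<omega> = enn2real (grid_sum (h n) \<omega>) / real (Suc n)" for n \<omega>
  have h0: "0 \<le> h n" for n by (simp add: h_def)
  have [measurable]: "V n \<in> borel_measurable M" for n
    using measurable_grid_sum[OF h0[of n], measurable] unfolding V_def by measurable
  have approx: "AE \<omega> in M. \<forall>n. I \<omega> \<le> V n \<omega> \<and> V n \<omega> \<le> I \<omega> + h n \<and> exp (- Y \<omega>) \<le> V n \<omega> - h n"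
    unfolding AE_all_countable V_def h_def using grid_sum_approximation[of "Suc n" for n] by blast
  have h1: "h n \<le> 1" for n by (simp add: h_def)
  have h_lim: "h \<longlonglongrightarrow> 0" unfolding h_def by real_asymp
  have lim: "AE \<omega> in M. (\<lambda>n. V n \<omega>) \<longlonglongrightarrow> I \<omega>"
    using approx
  proof eventually_elim
    case (elim \<omega>)
    have "(\<lambda>n. I \<omega> + h n) \<longlonglongrightarrow> I \<omega> + 0" by (intro tendsto_add tendsto_const h_lim)
    then have "(\<lambda>n. I \<omega> + h n) \<longlonglongrightarrow> I \<omega>" by simp
    from tendsto_sandwich[OF _ _ tendsto_const this] show ?case using elim by simp
  qed
  have bounds: "AE \<omega> in M. \<forall>n. exp (- Y \<omega>) \<le> V n \<omega> \<and> V n \<omega> \<le> I \<omega> + 1"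
    using approx by eventually_elim (use h0 h1 in \<open>smt (verit)\<close>)
  have bounds': "AE \<omega> in M. \<forall>n. exp (- Y \<omega>) \<le> V n \<omega> - h n \<and> V n \<omega> - h n \<le> I \<omega> + 1"
    using approx by eventually_elim (use h0 h1 in \<open>smt (verit)\<close>)
  have lim': "AE \<omega> in M. (\<lambda>n. V n \<omega> - h n) \<longlonglongrightarrow> I \<omega>"
    using lim by eventually_elim (use tendsto_diff[OF _ h_lim] in force)
  note V_lim = integral_powr_tendsto[of V, OF _ bounds lim]
  note V_lim' = integral_powr_tendsto[of "\<lambda>n \<omega>. V n \<omega> - h n", OF _ bounds' lim']
  define E where "E n = real (Suc n) * (1 - exp (- exponent s / real (Suc n))) * (\<integral>\<omega>. V n \<omega> powr s \<partial>M)" for n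
  have grid: "s * (\<integral>\<omega>. V n \<omega> powr (s - 1) \<partial>M) \<le> E n"
    "E n \<le> s * (\<integral>\<omega>. (V n \<omega> - h n) powr (s - 1) \<partial>M)" for n
  proof -
    interpret R: iid_steps "step_law (h n)" by (rule iid_steps_step_law[OF h0])
    define N where "N = real (Suc n)"
    have N: "0 < N" by (simp add: N_def)
    have nh: "real (Suc n) * h n = 1" by (simp add: h_def del: of_nat_Suc)
    define m where "m = (\<integral>x. exp (- s * x) \<partial>step_law (h n))"
    have "m ^ Suc n = exp (- exponent s)"
      using laplace_transform_grid[OF h0[of n], of s "Suc n"] laplace[of s] s
      by (simp add: m_def nh del: of_nat_Suc power_Suc)
    also have "\<dots> = exp (- exponent s / N) ^ Suc n"
      by (simp add: N_def exp_of_nat_mult[symmetric] del: power_Suc of_nat_Suc)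
    finally have m: "m = exp (- exponent s / N)"
      by (rule power_eq_imp_eq_base) (auto simp: m_def)
    have fin: "(\<integral>\<^sup>+x. perpetuity x \<partial>R.S.S) < \<infinity>"
      using nn_integral_grid_sum_finite(2)[of "Suc n"] by (simp add: h_def)
    have int_m: "integrable (step_law (h n)) (\<lambda>x. exp (- s * x))"
      using s by (intro integrable_exp_neg_step_law h0) simp
    \<comment> \<open>Rescaling from the perpetuity to the Riemann sum: powers of \<open>N = 1 / h n\<close> factor out and cancel.\<close>
    have D: "enn2real (grid_sum (h n) \<omega>) = N * V n \<omega>" for \<omega> by (simp add: V_def N_def)
    have V0: "0 \<le> V n \<omega>" for \<omega> by (simp add: V_def)
    have pw: "(\<integral>x. enn2real (perpetuity x) powr p \<partial>R.S.S) = N powr p * (\<integral>\<omega>. V n \<omega> powr p \<partial>M)" for p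
      using integral_grid_sum(1)[OF h0, of "\<lambda>x. enn2real x powr p" n] N V0
      by (simp add: D powr_mult)
    have "AE \<omega> in M. (N * V n \<omega> - 1) powr (s - 1) = N powr (s - 1) * (V n \<omega> - h n) powr (s - 1)"
      using bounds'
    proof eventually_elim
      case (elim \<omega>)
      have "N * V n \<omega> - 1 = N * (V n \<omega> - h n)" using nh by (simp add: N_def right_diff_distrib del: of_nat_Suc)
      moreover have "0 \<le> V n \<omega> - h n" using elim exp_gt_zero[of "- Y \<omega>"] by (smt (verit))
      ultimately show ?case using N by (simp add: powr_mult)
    qed
    note scaled = this
    have ae: "(\<integral>\<omega>. (N * V n \<omega> - 1) powr (s - 1) \<partial>M) = (\<integral>\<omega>. N powr (s - 1) * (V n \<omega> - h n) powr (s - 1) \<partial>M)"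
      "integrable M (\<lambda>\<omega>. (N * V n \<omega> - 1) powr (s - 1)) \<longleftrightarrow> integrable M (\<lambda>\<omega>. N powr (s - 1) * (V n \<omega> - h n) powr (s - 1))"
      by (rule integral_cong_AE[OF _ _ scaled]; measurable) (rule integrable_cong_AE[OF _ _ scaled]; measurable)
    have pw': "(\<integral>x. (enn2real (perpetuity x) - 1) powr (s - 1) \<partial>R.S.S)
        = N powr (s - 1) * (\<integral>\<omega>. (V n \<omega> - h n) powr (s - 1) \<partial>M)"
      using integral_grid_sum(1)[OF h0, of "\<lambda>x. (enn2real x - 1) powr (s - 1)" n] by (simp add: D ae)
    have int': "integrable R.S.S (\<lambda>x. (enn2real (perpetuity x) - 1) powr (s - 1))"
      using integral_grid_sum(2)[OF h0, of "\<lambda>x. (enn2real x - 1) powr (s - 1)" n] V_lim'(2)[of "s - 1" n] s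
      by (simp add: D ae)
    have Ns: "N powr s = N powr (s - 1) * N" using N by (simp add: powr_diff)
    have E: "N powr (s - 1) * E n = (1 - m) * (N powr s * (\<integral>\<omega>. V n \<omega> powr s \<partial>M))"
      unfolding E_def m Ns N_def[symmetric] by (simp only: mult_ac)
    note b = R.perpetuity_moment_bounds[OF fin s int_m, folded m_def, unfolded pw pw']
    have "N powr (s - 1) * (s * (\<integral>\<omega>. V n \<omega> powr (s - 1) \<partial>M)) \<le> N powr (s - 1) * E n"
      using b(1) unfolding E by (simp only: mult_ac)
    then show "s * (\<integral>\<omega>. V n \<omega> powr (s - 1) \<partial>M) \<le> E n"
      using N by simp
    have "N powr (s - 1) * E n \<le> N powr (s - 1) * (s * (\<integral>\<omega>. (V n \<omega> - h n) powr (s - 1) \<partial>M))"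
      using b(2)[OF int'] unfolding E by (simp only: mult_ac)
    then show "E n \<le> s * (\<integral>\<omega>. (V n \<omega> - h n) powr (s - 1) \<partial>M)"
      using N by simp
  qed
  have "(\<lambda>n. real (Suc n) * (1 - exp (- exponent s / real (Suc n)))) \<longlonglongrightarrow> exponent s"
    by real_asymp
  then have E_lim: "E \<longlonglongrightarrow> exponent s * (\<integral>\<omega>. I \<omega> powr s \<partial>M)"
    unfolding E_def using s by (intro tendsto_mult V_lim(3)) auto
  have "s * (\<integral>\<omega>. I \<omega> powr (s - 1) \<partial>M) \<le> exponent s * (\<integral>\<omega>. I \<omega> powr s \<partial>M)"
    using s grid(1) by (intro LIMSEQ_le[OF tendsto_mult[OF tendsto_const V_lim(3)] E_lim]) auto
  moreover have "exponent s * (\<integral>\<omega>. I \<omega> powr s \<partial>M) \<le> s * (\<integral>\<omega>. I \<omega> powr (s - 1) \<partial>M)"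
    using s grid(2) by (intro LIMSEQ_le[OF E_lim tendsto_mult[OF tendsto_const V_lim'(3)]]) auto
  ultimately show ?thesis by simp
qed

abbreviation X :: "'a \<Rightarrow> real" where "X \<equiv> log_exp_functional \<xi>"

lemma measurable_X[measurable]: "X \<in> borel_measurable M"
  unfolding log_exp_functional_def by measurable

lemma exp_mult_X: "AE \<omega> in M. exp (s * X \<omega>) = I \<omega> powr s"
  using exp_neg_Y_le_I
proof eventually_elim
  case (elim \<omega>)
  then have "0 < I \<omega>" using exp_gt_zero[of "- Y \<omega>"] by linarith
  then show ?case by (simp add: log_exp_functional_def I_def powr_def)
qed

lemma integrable_exp_X:
  assumes "s \<le> 1"
  shows "integrable M (\<lambda>\<omega>. exp (s * X \<omega>))"
  by (rule integrable_cong_AE[THEN iffD2, OF _ _ exp_mult_X integrable_I_powr[OF assms]]) measurable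

definition mellin :: "complex \<Rightarrow> complex" where
  "mellin z = (\<integral>\<omega>. exp (z * of_real (X \<omega>)) \<partial>M)"

lemma mellin_of_real: "mellin (of_real s) = of_real (\<integral>\<omega>. I \<omega> powr s \<partial>M)"
proof -
  have "mellin (of_real s) = (\<integral>\<omega>. of_real (exp (s * X \<omega>)) \<partial>M)"
    by (simp add: mellin_def exp_of_real[symmetric])
  also have "\<dots> = of_real (\<integral>\<omega>. exp (s * X \<omega>) \<partial>M)" by simp
  also have "(\<integral>\<omega>. exp (s * X \<omega>) \<partial>M) = (\<integral>\<omega>. I \<omega> powr s \<partial>M)"
    by (rule integral_cong_AE[OF _ _ exp_mult_X]) measurable
  finally show ?thesis .
qed

lemma mellin_holomorphic: "mellin holomorphic_on {z. Re z < 1}"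
  unfolding mellin_def by (rule moment_generating_function_holomorphic) (auto intro: integrable_exp_X)

text \<open>
  Both sides are holomorphic on the half-plane and agree on \<open>(0, 1)\<close> by \<open>functional_equation_real\<close>.
\<close>

lemma mellin_functional_equation:
  assumes z: "Re z < 1"
  shows "mellin (z - 1) = ratio z * mellin z"
proof -
  let ?D = "{z :: complex. Re z < 1}"
  have "mellin (z - 1) - ratio z * mellin z = 0"
  proof (rule analytic_continuation[of "\<lambda>z. mellin (z - 1) - ratio z * mellin z" ?D "of_real ` {0<..<1}" 0])
    have "(\<lambda>z. mellin (z - 1)) holomorphic_on ?D"
    proof -
      have "(\<lambda>z. z - 1) holomorphic_on ?D" by (intro holomorphic_intros)
      from holomorphic_on_compose_gen[OF this mellin_holomorphic]
      show ?thesis by (simp add: o_def image_subset_iff)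
    qed
    then show "(\<lambda>z. mellin (z - 1) - ratio z * mellin z) holomorphic_on ?D"
      by (intro holomorphic_intros mellin_holomorphic holomorphic_on_subset[OF exponent_quotient_holomorphic]) auto
    show "open ?D" by (rule open_halfspace_Re_lt)
    show "connected ?D" by (intro convex_connected convex_halfspace_Re_lt)
    show "0 islimpt (of_real ` {0<..<1} :: complex set)" by (rule zero_islimpt_of_real) simp
    fix v :: complex assume "v \<in> of_real ` {0<..<1}"
    then obtain s where s: "v = of_real s" "0 < s" "s < 1" by auto
    have "(\<integral>\<omega>. I \<omega> powr (s - 1) \<partial>M) = exponent s / s * (\<integral>\<omega>. I \<omega> powr s \<partial>M)"
      using functional_equation_real[OF s(2,3)] s(2) by (simp add: field_simps)
    moreover have "v - 1 = of_real (s - 1)" by (simp add: s(1))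
    ultimately show "mellin (v - 1) - ratio v * mellin v = 0"
      using s(2) by (simp only: mellin_of_real s(1) exponent_quotient_of_real) simp
  qed (use z in auto)
  then show ?thesis by simp
qed

theorem log_exp_functional_not_infinitely_divisible: "\<not> infinitely_divisible (distr M borel X)"
proof
  assume inf_div: "infinitely_divisible (distr M borel X)"
  obtain w where w: "Re w \<le> 0" "ratio w = 0" by (rule exponent_quotient_has_zero)
  have "(\<integral>x. exp ((w - 1) * of_real x) \<partial>distr M borel X) \<noteq> 0"
  proof (rule infinitely_divisible_moment_generating_function_nonzero[OF inf_div])
    show "integrable (distr M borel X) (\<lambda>x. exp (s * x))" if "s < 1" for s
      using integrable_exp_X[of s] that by (subst integrable_distr_eq) auto
  qed (use w in auto)
  then have "mellin (w - 1) \<noteq> 0" by (subst (asm) integral_distr) (auto simp: mellin_def)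
  then show False using mellin_functional_equation[of w] w by simp
qed

end

text \<open>
  A tail vanishing beyond \<open>c\<close> confines the jumps to \<open>(0, c]\<close>, where \<open>x\<close> is at most a multiple of
  \<open>min x 1\<close>.
\<close>

lemma levy_measure_bounded_jumps:
  assumes levy: "levy_measure \<Lambda>" and a: "0 \<le> a" and c: "0 < c"
    and nontrivial: "emeasure \<Lambda> {0<..} \<noteq> 0" and tail: "\<forall>x>c. emeasure \<Lambda> {x<..} = 0"
  shows "bounded_jump_measure a c \<Lambda>"
proof
  show sets[measurable_cong]: "sets \<Lambda> = sets borel" using levy by (simp add: levy_measure_def)
  have "{..0} \<in> null_sets \<Lambda>" using levy by (simp add: levy_measure_def null_sets_def)
  then have pos: "AE x in \<Lambda>. x \<notin> {..0}" by (rule AE_not_in)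
  have "{c + 1 / real (Suc n)<..} \<in> null_sets \<Lambda>" for n
    using tail sets by (auto simp: null_sets_def)
  then have "AE x in \<Lambda>. x \<notin> {c + 1 / real (Suc n)<..}" for n by (rule AE_not_in)
  then have "AE x in \<Lambda>. \<forall>n. x \<le> c + 1 / real (Suc n)"
    by (simp add: AE_all_countable not_less)
  then have le: "AE x in \<Lambda>. x \<le> c"
  proof eventually_elim
    case (elim x)
    have "(\<lambda>n. c + 1 / real (Suc n)) \<longlonglongrightarrow> c" by real_asymp
    then show ?case by (rule LIMSEQ_le_const) (use elim in auto)
  qed
  show support: "AE x in \<Lambda>. 0 < x \<and> x \<le> c" using pos le by eventually_elim auto
  have "(\<integral>\<^sup>+x. ennreal (norm x) \<partial>\<Lambda>) \<le> (\<integral>\<^sup>+x. ennreal (max 1 c) * ennreal (min x 1) \<partial>\<Lambda>)"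
  proof (rule nn_integral_mono_AE)
    show "AE x in \<Lambda>. ennreal (norm x) \<le> ennreal (max 1 c) * ennreal (min x 1)"
      using support
    proof eventually_elim
      case (elim x)
      have "x \<le> max 1 c * min x 1"
      proof (cases "x \<le> 1")
        case True
        have "1 * x \<le> max 1 c * x" using elim by (intro mult_right_mono) auto
        then show ?thesis using True by simp
      qed (use elim in auto)
      then show ?case using elim by (simp add: ennreal_mult[symmetric] ennreal_leI)
    qed
  qed
  also have "\<dots> = ennreal (max 1 c) * (\<integral>\<^sup>+x. ennreal (min x 1) \<partial>\<Lambda>)"
    by (rule nn_integral_cmult) measurable
  also have "\<dots> < \<infinity>" using levy by (simp add: levy_measure_def ennreal_mult_less_top)
  finally show "integrable \<Lambda> (\<lambda>x. x)" by (intro integrableI_bounded) measurable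
  have "emeasure \<Lambda> {0<..} \<le> emeasure \<Lambda> (space \<Lambda>)" by (rule emeasure_space)
  then show "emeasure \<Lambda> (space \<Lambda>) \<noteq> 0" using nontrivial by auto
qed (fact a c)+

text \<open>
  Here \<open>ln 0 = 0\<close> needs care: the Laplace transform at \<open>1\<close> cannot be \<open>0\<close> since the exponent is positive
  there. Hence the survival probability, which is the Laplace transform at \<open>0\<close>, is positive as well, and
  its logarithm \<open>- exponent 0 = 0\<close> makes it equal to \<open>1\<close>.
\<close>

lemma bounded_jump_subordinatorI:
  assumes sub: "subordinator M \<xi>" and meas: "bounded_jump_measure a c \<Lambda>"
    and exponent: "\<And>l. 0 \<le> l \<Longrightarrow> laplace_exponent M \<xi> l = bounded_jump_measure.exponent a \<Lambda> l"
  shows "bounded_jump_subordinator M \<xi> a c \<Lambda>"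
proof -
  interpret subordinator M \<xi> by fact
  interpret bounded_jump_measure a c \<Lambda> by fact
  define m where "m l = (\<integral>\<omega>. exp_neg l (\<xi> 1 \<omega>) \<partial>M)" for l
  have ln_m: "ln (m l) = - exponent l" if "0 \<le> l" for l
    using assms(3)[OF that] by (simp add: laplace_exponent_def m_def)
  have [measurable]: "\<xi> 1 \<in> borel_measurable M" by (rule measurable_process) simp
  have [measurable]: "(\<lambda>\<omega>. exp_neg l (\<xi> 1 \<omega>)) \<in> borel_measurable M" for l
    unfolding exp_neg_def by measurable
  have int: "integrable M (\<lambda>\<omega>. exp_neg l (\<xi> 1 \<omega>))" if "0 \<le> l" for l
    by (rule integrable_const_bound[of _ 1]) (use that exp_neg_nonneg exp_neg_le_1 in auto)
  have "m 1 \<noteq> 0" using ln_m[of 1] exponent_pos[of 1] by auto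
  moreover have "0 \<le> m 1" unfolding m_def by (intro integral_nonneg_AE AE_I2 exp_neg_nonneg)
  moreover have "m 1 \<le> m 0"
    unfolding m_def by (intro integral_mono int) (auto simp: exp_neg_def)
  ultimately have "0 < m 0" by linarith
  then have m0: "m 0 = 1" using ln_m[of 0] exponent_0 by simp
  have "m 0 = (\<integral>\<omega>. indicator {\<omega> \<in> space M. \<xi> 1 \<omega> < \<infinity>} \<omega> \<partial>M)"
    unfolding m_def
    by (intro Bochner_Integration.integral_cong) (auto simp: exp_neg_def indicator_def less_top[symmetric])
  also have "\<dots> = prob {\<omega> \<in> space M. \<xi> 1 \<omega> < \<infinity>}" by simp
  finally have "prob {\<omega> \<in> space M. \<xi> 1 \<omega> < \<infinity>} = 1" using m0 by simp
  then have fin: "AE \<omega> in M. \<xi> 1 \<omega> < \<infinity>" by (subst (asm) prob_Collect_eq_1) auto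
  show ?thesis
  proof
    show "AE \<omega> in M. \<xi> 1 \<omega> < \<infinity>" by (rule fin)
    fix l :: real assume l: "0 \<le> l"
    have eq: "m l = (\<integral>\<omega>. exp (- l * enn2real (\<xi> 1 \<omega>)) \<partial>M)"
      unfolding m_def by (rule integral_cong_AE) (use fin in \<open>measurable, eventually_elim, simp add: exp_neg_def\<close>)
    have "(\<integral>\<omega>. 0 \<partial>M) < (\<integral>\<omega>. exp (- l * enn2real (\<xi> 1 \<omega>)) \<partial>M)"
    proof (rule integral_less_AE_space)
      show "integrable M (\<lambda>\<omega>. exp (- l * enn2real (\<xi> 1 \<omega>)))"
        by (rule integrable_const_bound[of _ 1]) (use l in auto)
    qed (auto simp: emeasure_space_1)
    then have "0 < m l" by (simp add: eq)
    then show "(\<integral>\<omega>. exp (- l * enn2real (\<xi> 1 \<omega>)) \<partial>M) = exp (- exponent l)"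
      using ln_m[OF l] by (metis eq exp_ln)
  qed
qed

theorem corollary1:
  fixes M :: "'a measure" and \<xi> :: "real \<Rightarrow> 'a \<Rightarrow> ennreal"
    and q a c :: real and \<Lambda> :: "real measure"
  assumes "subordinator M \<xi>"
    and "has_characteristics M \<xi> q a \<Lambda>"
    and "q = 0"
    and "emeasure \<Lambda> {0<..} \<noteq> 0"
    and "0 < c"
    and "\<forall>x>c. levy_tail q \<Lambda> x = 0"
  shows "\<not> infinitely_divisible (distr M borel (log_exp_functional \<xi>))"
proof -
  have meas: "bounded_jump_measure a c \<Lambda>"
    using assms by (intro levy_measure_bounded_jumps) (auto simp: has_characteristics_def levy_tail_def)
  have "bounded_jump_subordinator M \<xi> a c \<Lambda>"
  proof (rule bounded_jump_subordinatorI[OF assms(1) meas])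
    show "laplace_exponent M \<xi> l = bounded_jump_measure.exponent a \<Lambda> l" if "0 \<le> l" for l
      using assms(2,3) that
      by (simp add: has_characteristics_def bounded_jump_measure.exponent_def[OF meas])
  qed
  then show ?thesis by (rule bounded_jump_subordinator.log_exp_functional_not_infinitely_divisible)
qed

end
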